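(* Let $G$ be a connected plane graph with a perfect matching. Then the resonance graph $R(G)$ is connected if and only if $I[C]$ is an elementary bipartite graph for each nice cycle $C$ of $G$.
   Context: For a plane graph $G$, the resonance graph $R(G)$ has as vertices the perfect matchings of $G$, and two perfect matchings $M_1,M_2$ are adjacent iff $M_1\oplus M_2$ (symmetric difference) is exactly the boundary cycle of one interior (bounded) face of $G$. A cycle $C$ of $G$ is nice if $G-V(C)$ has a perfect matching (equivalently, $C$ is $M$-alternating for some perfect matching $M$ of $G$). For a cycle $C$ of a plane graph, $I[C]$ denotes the subgraph of $G$ consisting of $C$ together with everything of $G$ lying in the interior of $C$. An edge is allowed if it lies in some perfect matching; a graph is elementary if its allowed edges form a connected subgraph (for bipartite graphs: connected and every edge allowed). *)

theory Defs
  imports "HOL-Analysis.Analysis"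
begin

text \<open>Graphs: vertices are points of the plane (complex numbers), edges are
  2-element vertex sets (simple graphs), and each edge e is drawn as an arc
  \<open>\<gamma> e\<close> joining its two end points.\<close>

definition plane_graph ::
  "complex set \<Rightarrow> complex set set \<Rightarrow> (complex set \<Rightarrow> real \<Rightarrow> complex) \<Rightarrow> bool" where
  "plane_graph V E \<gamma> \<longleftrightarrow>
     finite V \<and>
     (\<forall>e\<in>E. \<exists>u v. e = {u, v} \<and> u \<noteq> v \<and> u \<in> V \<and> v \<in> V) \<and>
     (\<forall>e\<in>E. arc (\<gamma> e) \<and> {pathstart (\<gamma> e), pathfinish (\<gamma> e)} = e) \<and>
     (\<forall>e\<in>E. path_image (\<gamma> e) \<inter> V = e) \<and>
     (\<forall>e\<in>E. \<forall>e'\<in>E. e \<noteq> e' \<longrightarrow> path_image (\<gamma> e) \<inter> path_image (\<gamma> e') = e \<inter> e')"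

definition drawing :: "(complex set \<Rightarrow> real \<Rightarrow> complex) \<Rightarrow> complex set set \<Rightarrow> complex set" where
  "drawing \<gamma> C = (\<Union>e\<in>C. path_image (\<gamma> e))"

definition graph_connected :: "'v set \<Rightarrow> 'v set set \<Rightarrow> bool" where
  "graph_connected V E \<longleftrightarrow> (\<forall>u\<in>V. \<forall>v\<in>V. (\<lambda>x y. {x, y} \<in> E)\<^sup>*\<^sup>* u v)"

definition perfect_matching :: "'v set \<Rightarrow> 'v set set \<Rightarrow> 'v set set \<Rightarrow> bool" where
  "perfect_matching V E M \<longleftrightarrow> M \<subseteq> E \<and> (\<forall>v\<in>V. \<exists>!e. e \<in> M \<and> v \<in> e)"

definition is_cycle :: "'v set set \<Rightarrow> bool" where
  "is_cycle C \<longleftrightarrow> finite C \<and> C \<noteq> {} \<and> graph_connected (\<Union>C) C \<and>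
     (\<forall>v\<in>\<Union>C. card {e\<in>C. v \<in> e} = 2)"

definition cycle_of :: "'v set \<Rightarrow> 'v set set \<Rightarrow> 'v set set \<Rightarrow> bool" where
  "cycle_of V E C \<longleftrightarrow> C \<subseteq> E \<and> is_cycle C"

definition nice_cycle :: "'v set \<Rightarrow> 'v set set \<Rightarrow> 'v set set \<Rightarrow> bool" where
  "nice_cycle V E C \<longleftrightarrow> cycle_of V E C \<and>
     (\<exists>M. perfect_matching (V - \<Union>C) {e\<in>E. e \<inter> \<Union>C = {}} M)"

definition interior_face :: "complex set set \<Rightarrow> (complex set \<Rightarrow> real \<Rightarrow> complex) \<Rightarrow> complex set \<Rightarrow> bool" where
  "interior_face E \<gamma> F \<longleftrightarrow> F \<in> components (- drawing \<gamma> E) \<and> bounded F"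

definition face_boundary :: "complex set set \<Rightarrow> (complex set \<Rightarrow> real \<Rightarrow> complex) \<Rightarrow> complex set \<Rightarrow> complex set set" where
  "face_boundary E \<gamma> F = {e\<in>E. path_image (\<gamma> e) \<subseteq> frontier F}"

definition resonance_adj ::
  "complex set \<Rightarrow> complex set set \<Rightarrow> (complex set \<Rightarrow> real \<Rightarrow> complex) \<Rightarrow> complex set set \<Rightarrow> complex set set \<Rightarrow> bool" where
  "resonance_adj V E \<gamma> M1 M2 \<longleftrightarrow> perfect_matching V E M1 \<and> perfect_matching V E M2 \<and>
     (\<exists>F. interior_face E \<gamma> F \<and> is_cycle (face_boundary E \<gamma> F) \<and>
          (M1 - M2) \<union> (M2 - M1) = face_boundary E \<gamma> F)"

definition resonance_connected ::
  "complex set \<Rightarrow> complex set set \<Rightarrow> (complex set \<Rightarrow> real \<Rightarrow> complex) \<Rightarrow> bool" where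
  "resonance_connected V E \<gamma> \<longleftrightarrow>
     (\<forall>M1 M2. perfect_matching V E M1 \<longrightarrow> perfect_matching V E M2 \<longrightarrow>
        (resonance_adj V E \<gamma>)\<^sup>*\<^sup>* M1 M2)"

definition IC_vertices :: "complex set \<Rightarrow> (complex set \<Rightarrow> real \<Rightarrow> complex) \<Rightarrow> complex set set \<Rightarrow> complex set" where
  "IC_vertices V \<gamma> C = {v\<in>V. v \<in> drawing \<gamma> C \<union> inside (drawing \<gamma> C)}"

definition IC_edges :: "complex set set \<Rightarrow> (complex set \<Rightarrow> real \<Rightarrow> complex) \<Rightarrow> complex set set \<Rightarrow> complex set set" where
  "IC_edges E \<gamma> C = {e\<in>E. path_image (\<gamma> e) \<subseteq> drawing \<gamma> C \<union> inside (drawing \<gamma> C)}"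

definition bipartite :: "'v set \<Rightarrow> 'v set set \<Rightarrow> bool" where
  "bipartite V E \<longleftrightarrow> (\<exists>A. A \<subseteq> V \<and> (\<forall>e\<in>E. card (e \<inter> A) = 1 \<and> card (e - A) = 1))"

definition allowed_edge :: "'v set \<Rightarrow> 'v set set \<Rightarrow> 'v set \<Rightarrow> bool" where
  "allowed_edge V E e \<longleftrightarrow> (\<exists>M. perfect_matching V E M \<and> e \<in> M)"

definition elementary :: "'v set \<Rightarrow> 'v set set \<Rightarrow> bool" where
  "elementary V E \<longleftrightarrow> (\<exists>M. perfect_matching V E M) \<and>
     graph_connected V {e\<in>E. allowed_edge V E e}"

end

theory Submission
  imports Defs "HOL-Complex_Analysis.Winding_Numbers"
begin

text \<open>Suppose first that the resonance graph is connected and let C be a nice cycle, alternating for a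
  perfect matching M.  A walk from M to \<open>M \<oplus> C\<close> writes C as a sum modulo 2 of boundary cycles of faces.
  Modulo 2 the winding number about a point is additive over edge sets, so every face inside C
  occurs in this sum.  The boundaries of these faces are alternating, hence even, so I[C] has no odd cycle,
  and every edge of I[C] lies in a perfect matching of the whole graph; a cut argument turns
  the latter into a perfect matching of I[C].

  Conversely, two perfect matchings differ by flips of alternating cycles C, and such a flip is
  a walk in the resonance graph by induction on the size of I[C]: if I[C] is not just C, it has
  a perfect matching N that uses an edge leaving C, and C is not among the cycles of
  \<open>M \<oplus> N\<close> and \<open>(M \<oplus> C) \<oplus> N\<close>.\<close>

section \<open>Cycles as edge sets\<close>

text \<open>A face enters only through the edges whose whole curve lies in its frontier;
  \<open>frontier_face_edge\<close> excludes edges that do so only in part, and vertices, being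
  finitely many, are discarded wherever they would disturb an argument. A single edge has no
  integral winding number. Once a branch of the logarithm at its ends is subtracted, an integer
  remains whose sign depends on the direction of the edge but whose parity does not; so sums over
  cycles can be taken modulo 2 without orienting anything. A walk may also flip faces outside C, or
  one face several times. All that is used of it is that the points inside C, off curves and
  vertices, lie in flipped faces. Such a face puts its edges into perfect matchings of the whole
  graph, but these may match vertices of C to the outside and then do not restrict to I[C]. Hence
  the cut argument: in a bipartite graph an edge in no perfect matching crosses a balanced set that
  no perfect matching crosses, and the count of colours behind this looks at one side of the cut
  only, so that the side avoiding C can be chosen.\<close>

definition simple_edges :: "'v set set \<Rightarrow> bool" where
  "simple_edges E \<longleftrightarrow> finite E \<and> (\<forall>e\<in>E. card e = 2)"

definition edges_at :: "'v set set \<Rightarrow> 'v \<Rightarrow> 'v set set" where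
  "edges_at E v = {e\<in>E. v \<in> e}"

fun path_edges :: "'v list \<Rightarrow> 'v set set" where
  "path_edges [] = {}"
| "path_edges [x] = {}"
| "path_edges (x # y # xs) = insert {x, y} (path_edges (y # xs))"

text \<open>A cycle only for distinct lists of length at least 3: with two vertices the closing edge
  is the path edge itself.\<close>

definition cyc_edges :: "'v list \<Rightarrow> 'v set set" where
  "cyc_edges vs = insert {last vs, hd vs} (path_edges vs)"

lemma simple_edges_subset: "simple_edges E \<Longrightarrow> D \<subseteq> E \<Longrightarrow> simple_edges D"
  by (auto simp: simple_edges_def intro: finite_subset)

lemma simple_edges_finite [dest]: "simple_edges E \<Longrightarrow> finite E"
  by (simp add: simple_edges_def)

lemma simple_edges_finite_Union: "simple_edges E \<Longrightarrow> finite (\<Union>E)"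
  by (metis simple_edges_def card.infinite finite_Union zero_neq_numeral)

lemma simple_edgesE:
  assumes "simple_edges E" "e \<in> E" "v \<in> e"
  obtains w where "e = {v, w}" "w \<noteq> v"
  using assms unfolding simple_edges_def card_2_iff by (metis insert_commute insertE singletonD)

lemma finite_edges_at [simp]: "finite E \<Longrightarrow> finite (edges_at E v)"
  by (simp add: edges_at_def)

lemma edges_at_mono: "D \<subseteq> E \<Longrightarrow> edges_at D v \<subseteq> edges_at E v"
  by (auto simp: edges_at_def)

lemma path_edges_append:
  "xs \<noteq> [] \<Longrightarrow> ys \<noteq> [] \<Longrightarrow>
    path_edges (xs @ ys) = insert {last xs, hd ys} (path_edges xs \<union> path_edges ys)"
  by (induction xs rule: path_edges.induct; cases ys) auto

lemma Union_path_edges_subset: "\<Union>(path_edges vs) \<subseteq> set vs"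
  by (induction vs rule: path_edges.induct) auto

lemma Union_path_edges: "length vs \<ge> 2 \<Longrightarrow> \<Union>(path_edges vs) = set vs"
proof (induction vs rule: path_edges.induct)
  case (3 x y xs)
  then show ?case by (cases xs) auto
qed auto

lemma finite_path_edges [simp]: "finite (path_edges vs)"
  by (induction vs rule: path_edges.induct) auto

lemma finite_cyc_edges [simp]: "finite (cyc_edges vs)"
  by (simp add: cyc_edges_def)

lemma Union_cyc_edges: "length vs \<ge> 2 \<Longrightarrow> \<Union>(cyc_edges vs) = set vs"
  using Union_path_edges[of vs] by (cases vs) (auto simp: cyc_edges_def)

lemma cyc_edges_rotate: "cyc_edges (xs @ ys) = cyc_edges (ys @ xs)"
  by (cases "xs = []"; cases "ys = []")
     (auto simp: cyc_edges_def path_edges_append insert_commute)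

lemma successively_iff_path_edges:
  "successively (\<lambda>x y. {x, y} \<in> E) vs \<longleftrightarrow> path_edges vs \<subseteq> E"
  by (induction vs rule: path_edges.induct) auto

lemma edges_at_cyc_edges_Cons:
  assumes "distinct (v # w # zs)" "zs \<noteq> []"
  shows "edges_at (cyc_edges (v # w # zs)) v = {{last zs, v}, {v, w}}"
  using assms Union_path_edges_subset[of "w # zs"]
  by (auto simp: edges_at_def cyc_edges_def)

text \<open>Rotation brings v to the front, where its two edges can be read off. With at least 3
  vertices \<open>zs\<close> is nonempty, so in a distinct list the neighbours \<open>w\<close> and
  \<open>last zs\<close> differ.\<close>

lemma split_at_vertex:
  assumes "v \<in> set vs" "length vs \<ge> 3"
  obtains xs ys w zs where "vs = xs @ ys" "ys @ xs = v # w # zs" "zs \<noteq> []"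
proof -
  obtain xs ys where *: "vs = xs @ v # ys" using assms by (meson split_list)
  have "length (ys @ xs) \<ge> 2" using assms(2) * by simp
  then obtain w zs where "ys @ xs = w # zs" "zs \<noteq> []"
    by (cases "ys @ xs" rule: path_edges.cases) auto
  with * show ?thesis using that[of xs "v # ys" w zs] by auto
qed

lemma card_edges_at_cyc_edges:
  assumes "distinct vs" "length vs \<ge> 3" "v \<in> set vs"
  shows "card (edges_at (cyc_edges vs) v) = 2"
proof -
  obtain xs ys w zs where s: "vs = xs @ ys" "ys @ xs = v # w # zs" "zs \<noteq> []"
    using split_at_vertex assms by metis
  have "distinct (v # w # zs)" using s assms(1) by (metis distinct_append distinct_append inf_commute)
  moreover have "cyc_edges vs = cyc_edges (v # w # zs)" using s cyc_edges_rotate by metis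
  moreover have "{last zs, v} \<noteq> {v, w}" using calculation(1) s(3) by (auto simp: doubleton_eq_iff)
  ultimately show ?thesis using edges_at_cyc_edges_Cons s(3) by (metis card_2_iff)
qed

lemma rtranclp_sym:
  "(\<lambda>x y. {x, y} \<in> E)\<^sup>*\<^sup>* u v \<Longrightarrow> (\<lambda>x y. {x, y} \<in> E)\<^sup>*\<^sup>* v u"
proof (induction rule: rtranclp_induct)
  case (step y z)
  then have "{z, y} \<in> E" by (simp add: insert_commute)
  with step.IH show ?case by (rule converse_rtranclp_into_rtranclp[rotated])
qed auto

lemma graph_connectedI_root:
  assumes "\<And>v. v \<in> V \<Longrightarrow> (\<lambda>x y. {x, y} \<in> E)\<^sup>*\<^sup>* r v"
  shows "graph_connected V E"
  unfolding graph_connected_def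
proof (intro ballI)
  fix u v assume "u \<in> V" "v \<in> V"
  then have "(\<lambda>x y. {x, y} \<in> E)\<^sup>*\<^sup>* u r" "(\<lambda>x y. {x, y} \<in> E)\<^sup>*\<^sup>* r v"
    using assms rtranclp_sym by metis+
  then show "(\<lambda>x y. {x, y} \<in> E)\<^sup>*\<^sup>* u v" by (rule rtranclp_trans)
qed

lemma graph_connected_mono: "graph_connected V E \<Longrightarrow> E \<subseteq> E' \<Longrightarrow> graph_connected V E'"
  unfolding graph_connected_def by (metis (no_types, lifting) mono_rtranclp subsetD)

lemma path_edges_reach:
  "v \<in> set vs \<Longrightarrow> (\<lambda>x y. {x, y} \<in> path_edges vs)\<^sup>*\<^sup>* (hd vs) v"
proof (induction vs rule: path_edges.induct)
  case (3 x y xs)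
  show ?case
  proof (cases "v = x")
    case False
    then have "(\<lambda>a b. {a, b} \<in> path_edges (y # xs))\<^sup>*\<^sup>* y v" using 3 by auto
    then have "(\<lambda>a b. {a, b} \<in> path_edges (x # y # xs))\<^sup>*\<^sup>* y v"
      by (rule rtranclp_mono[THEN predicate2D, rotated]) auto
    then show ?thesis by (simp add: converse_rtranclp_into_rtranclp[of _ x y])
  qed auto
qed auto

lemma graph_connected_cut:
  assumes "graph_connected V E" "x \<in> V" "y \<in> V" "x \<in> X" "y \<notin> X"
  obtains u v where "{u, v} \<in> E" "u \<in> X" "v \<notin> X"
proof -
  have "(\<lambda>x y. {x, y} \<in> E)\<^sup>*\<^sup>* x y" using assms by (auto simp: graph_connected_def)
  then have "y \<in> X \<or> (\<exists>u v. {u, v} \<in> E \<and> u \<in> X \<and> v \<notin> X)"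
    by (induction rule: rtranclp_induct) (use assms in auto)
  with assms that show thesis by auto
qed

lemma is_cycle_cyc_edges:
  assumes "distinct vs" "length vs \<ge> 3"
  shows "is_cycle (cyc_edges vs)"
proof -
  have U: "\<Union>(cyc_edges vs) = set vs" by (rule Union_cyc_edges) (use assms in simp)
  have "graph_connected (set vs) (path_edges vs)"
    by (rule graph_connectedI_root) (rule path_edges_reach)
  then have "graph_connected (set vs) (cyc_edges vs)"
    by (rule graph_connected_mono) (auto simp: cyc_edges_def)
  moreover have "\<forall>v\<in>set vs. card {e \<in> cyc_edges vs. v \<in> e} = 2"
    using card_edges_at_cyc_edges[OF assms] by (simp add: edges_at_def)
  ultimately show ?thesis
    unfolding is_cycle_def U by (simp add: cyc_edges_def)
qed

lemma is_cycle_edges_at: "is_cycle C \<Longrightarrow> v \<in> \<Union>C \<Longrightarrow> card (edges_at C v) = 2"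
  unfolding is_cycle_def edges_at_def by blast

lemma edges_at_empty_iff: "edges_at D v = {} \<longleftrightarrow> v \<notin> \<Union>D"
  by (auto simp: edges_at_def)

lemma simple_edges_nonempty: "simple_edges E \<Longrightarrow> e \<in> E \<Longrightarrow> e \<noteq> {}"
  by (auto simp: simple_edges_def)

text \<open>D already has degree 2 at its vertices, so it takes every edge of C there; connectedness
  of C spreads this to all vertices.\<close>

lemma subcycle_eq:
  assumes "simple_edges C" "is_cycle C" "D \<subseteq> C" "is_cycle D"
  shows "D = C"
proof -
  have f: "finite C" and con: "graph_connected (\<Union>C) C" using assms by (auto simp: is_cycle_def)
  have same: "edges_at D v = edges_at C v" if "v \<in> \<Union>D" for v
  proof (rule card_subset_eq)
    have "v \<in> \<Union>C" using that assms(3) by blast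
    then show "card (edges_at D v) = card (edges_at C v)"
      using is_cycle_edges_at assms(2,4) that by metis
  qed (use f assms(3) edges_at_mono[OF assms(3)] in auto)
  obtain d where "d \<in> D" using assms(4) by (auto simp: is_cycle_def)
  then obtain x where x: "x \<in> \<Union>D" using simple_edges_nonempty[OF assms(1)] assms(3) by blast
  have "\<Union>C \<subseteq> \<Union>D"
  proof (rule ccontr)
    assume "\<not> \<Union>C \<subseteq> \<Union>D"
    then obtain y where "y \<in> \<Union>C" "y \<notin> \<Union>D" by blast
    then obtain u v where "{u, v} \<in> C" "u \<in> \<Union>D" "v \<notin> \<Union>D"
      using graph_connected_cut[OF con, of x y "\<Union>D"] x assms(3) by blast
    then show False using same[of u] by (auto simp: edges_at_def)
  qed
  have "C \<subseteq> D"
  proof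
    fix e assume e: "e \<in> C"
    then obtain v where "v \<in> e" using simple_edges_nonempty[OF assms(1)] by blast
    then show "e \<in> D" using same[of v] e \<open>\<Union>C \<subseteq> \<Union>D\<close> by (auto simp: edges_at_def)
  qed
  with assms(3) show ?thesis by blast
qed

text \<open>Close up a longest path at its first vertex.\<close>

lemma exists_cycle_list:
  assumes S: "simple_edges S" "S \<noteq> {}" and deg: "\<And>v. v \<in> \<Union>S \<Longrightarrow> card (edges_at S v) \<ge> 2"
  obtains vs where "distinct vs" "length vs \<ge> 3" "cyc_edges vs \<subseteq> S"
proof -
  define P where "P = {vs. set vs \<subseteq> \<Union>S \<and> distinct vs \<and> length vs \<ge> 2 \<and> path_edges vs \<subseteq> S}"
  have "finite P"
    by (rule finite_subset[OF _ finite_subset_distinct[OF simple_edges_finite_Union[OF S(1)]]]) (auto simp: P_def)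
  obtain a b where ab: "{a, b} \<in> S" "b \<noteq> a"
    using S simple_edges_nonempty simple_edgesE by (metis all_not_in_conv)
  then have "[a, b] \<in> P" by (auto simp: P_def)
  then obtain vs where vs: "vs \<in> P" "\<And>ws. ws \<in> P \<Longrightarrow> length ws \<le> length vs"
  proof -
    obtain n where "\<forall>s\<in>P. length s < n" using finite_maxlen[OF \<open>finite P\<close>] by blast
    then have "\<exists>vs. vs \<in> P \<and> (\<forall>ws. ws \<in> P \<longrightarrow> length ws \<le> length vs)"
      using \<open>[a, b] \<in> P\<close> by (intro ex_has_greatest_nat[of _ "[a, b]" _ n]) auto
    then show thesis using that by blast
  qed
  obtain v0 v1 rest where v: "vs = v0 # v1 # rest"
    using vs(1) by (cases vs; cases "tl vs") (auto simp: P_def)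
  have "v0 \<in> \<Union>S" using vs(1) v by (auto simp: P_def)
  have "\<not> edges_at S v0 \<subseteq> {{v0, v1}}"
  proof
    assume "edges_at S v0 \<subseteq> {{v0, v1}}"
    then have "card (edges_at S v0) \<le> 1" using card_mono[of "{{v0, v1}}" "edges_at S v0"] by simp
    with deg[OF \<open>v0 \<in> \<Union>S\<close>] show False by simp
  qed
  then obtain e where e: "e \<in> S" "v0 \<in> e" "e \<noteq> {v0, v1}" by (auto simp: edges_at_def)
  then obtain w where w: "e = {v0, w}" "w \<noteq> v0" using simple_edgesE[OF S(1)] by metis
  have "w \<in> set vs"
  proof (rule ccontr)
    assume "w \<notin> set vs"
    then have "w # vs \<in> P" using vs(1) e(1) w by (auto simp: P_def v insert_commute)
    then show False using vs(2) by fastforce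
  qed
  then have "w \<in> set rest" using e(3) w v by auto
  then obtain xs ys where xs: "rest = xs @ w # ys" by (meson split_list)
  define ws where "ws = v0 # v1 # xs @ [w]"
  have vw: "vs = ws @ ys" by (simp add: v xs ws_def)
  have "path_edges ws \<subseteq> S"
  proof (cases "ys = []")
    case False
    have "path_edges ws \<subseteq> path_edges (ws @ ys)"
      by (subst path_edges_append) (use False ws_def in auto)
    then show ?thesis using vs(1) vw by (auto simp: P_def)
  qed (use vs(1) vw in \<open>simp add: P_def\<close>)
  moreover have "distinct ws" using vs(1) vw by (auto simp: P_def)
  moreover have "{last ws, hd ws} \<in> S" using e w by (simp add: ws_def insert_commute)
  ultimately show thesis using that[of ws] by (auto simp: cyc_edges_def ws_def)
qed

text \<open>Some cycle list can be extracted from C, and it exhausts C because a cycle has no proper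
  subcycle.\<close>

lemma is_cycle_list:
  assumes "simple_edges C" "is_cycle C"
  obtains vs where "distinct vs" "length vs \<ge> 3" "C = cyc_edges vs"
proof -
  have "C \<noteq> {}" using assms(2) by (simp add: is_cycle_def)
  then obtain vs where vs: "distinct vs" "length vs \<ge> 3" "cyc_edges vs \<subseteq> C"
    using exists_cycle_list assms is_cycle_edges_at by (metis order_refl)
  then have "cyc_edges vs = C" using subcycle_eq assms is_cycle_cyc_edges by metis
  with vs that show thesis by blast
qed

section \<open>Parity of edge sets and odd cycles\<close>

lemma odd_card_sym_diff:
  assumes "finite A" "finite B"
  shows "odd (card (sym_diff A B)) \<longleftrightarrow> odd (card A) \<noteq> odd (card B)"
proof -
  have "card (sym_diff A B) = card (A - B) + card (B - A)"
    using assms by (intro card_Un_disjoint) auto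
  moreover have "card A = card (A - B) + card (A \<inter> B)" "card B = card (B - A) + card (A \<inter> B)"
    using assms by (metis card_Diff_subset_Int card_Int_Diff finite_Int Int_commute add.commute)+
  ultimately show ?thesis by auto
qed

lemma edges_at_sym_diff: "edges_at (sym_diff A B) v = sym_diff (edges_at A v) (edges_at B v)"
  by (auto simp: edges_at_def)

lemma edges_at_Diff: "edges_at (A - B) v = edges_at A v - edges_at B v"
  by (auto simp: edges_at_def)

text \<open>Peel off cycles: removing one of even size keeps all degrees even and the total
  odd.\<close>

lemma exists_odd_cycle:
  assumes "simple_edges S" "\<And>v. even (card (edges_at S v))" "odd (card S)"
  obtains D where "D \<subseteq> S" "is_cycle D" "odd (card D)"
proof -
  have "\<exists>D\<subseteq>S. is_cycle D \<and> odd (card D)" using assms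
  proof (induction "card S" arbitrary: S rule: less_induct)
    case less
    have fin: "finite S" using less.prems by blast
    have deg: "card (edges_at S v) \<ge> 2" if "v \<in> \<Union>S" for v
    proof -
      have "edges_at S v \<noteq> {}" using that edges_at_empty_iff by metis
      then have "card (edges_at S v) \<noteq> 0" using fin by simp
      with less.prems(2)[of v] show ?thesis by (metis One_nat_def less_2_cases not_le odd_one)
    qed
    have "S \<noteq> {}" using less.prems(3) by auto
    then obtain vs where vs: "distinct vs" "length vs \<ge> 3" "cyc_edges vs \<subseteq> S"
      using exists_cycle_list deg less.prems(1) by metis
    define D where "D = cyc_edges vs"
    have cyc: "is_cycle D" using vs is_cycle_cyc_edges D_def by blast
    show ?case
    proof (cases "odd (card D)")
      case True
      then show ?thesis using cyc vs D_def by blast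
    next
      case False
      have "D \<noteq> {}" using cyc by (simp add: is_cycle_def)
      have cD: "card (S - D) = card S - card D" "card D \<le> card S"
        using vs(3) fin by (auto simp: D_def card_Diff_subset finite_subset card_mono)
      have "card D > 0" using \<open>D \<noteq> {}\<close> by (simp add: D_def card_gt_0_iff)
      then have lt: "card (S - D) < card S" using cD by linarith
      have "even (card (edges_at (S - D) v))" for v
      proof -
        have "even (card (edges_at D v))"
          using is_cycle_edges_at[OF cyc, of v] edges_at_empty_iff[of D v] by (cases "v \<in> \<Union>D") auto
        then have "even (card (edges_at S v) - card (edges_at D v))" using less.prems(2)[of v] by simp
        moreover have "edges_at D v \<subseteq> edges_at S v" unfolding D_def by (rule edges_at_mono[OF vs(3)])
        ultimately show ?thesis
          using fin by (simp add: edges_at_Diff card_Diff_subset finite_subset)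
      qed
      moreover have "odd (card (S - D))" using cD False less.prems(3) by auto
      ultimately obtain D' where "D' \<subseteq> S - D" "is_cycle D'" "odd (card D')"
        using less.hyps[OF lt simple_edges_subset[OF less.prems(1) Diff_subset]] by blast
      then show ?thesis by blast
    qed
  qed
  with that show thesis by blast
qed

section \<open>Perfect matchings and alternating cycles\<close>

definition sgraph :: "'v set \<Rightarrow> 'v set set \<Rightarrow> bool" where
  "sgraph V E \<longleftrightarrow> finite V \<and> (\<forall>e\<in>E. card e = 2 \<and> e \<subseteq> V)"

text \<open>Both halves are demanded, so that flipping D merely exchanges them. For a cycle the
  first half implies the second (\<open>is_cycle_matching_alternating\<close>).\<close>

definition alternating :: "'v set set \<Rightarrow> 'v set set \<Rightarrow> bool" where
  "alternating M D \<longleftrightarrow>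
     perfect_matching (\<Union>D) D (D \<inter> M) \<and> perfect_matching (\<Union>D) D (D - M)"

lemma sgraph_simple_edges: "sgraph V E \<Longrightarrow> simple_edges E"
  unfolding sgraph_def simple_edges_def
  by (meson PowI finite_Pow_iff finite_subset subsetI)

lemma sgraph_Union: "simple_edges E \<Longrightarrow> sgraph (\<Union>E) E"
  using simple_edges_finite_Union by (auto simp: sgraph_def simple_edges_def)

lemma perfect_matching_unique:
  "perfect_matching V E M \<Longrightarrow> v \<in> V \<Longrightarrow> e \<in> M \<Longrightarrow> v \<in> e \<Longrightarrow> e' \<in> M \<Longrightarrow> v \<in> e' \<Longrightarrow> e = e'"
  unfolding perfect_matching_def by blast

lemma perfect_matching_ex1: "perfect_matching V E M \<Longrightarrow> v \<in> V \<Longrightarrow> \<exists>!e. e \<in> M \<and> v \<in> e"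
  by (simp add: perfect_matching_def)

lemma perfect_matchingE:
  assumes "perfect_matching V E M" "v \<in> V"
  obtains e where "e \<in> M" "v \<in> e" "e \<in> E"
  using assms unfolding perfect_matching_def by blast

lemma card_perfect_matching:
  assumes "sgraph V E" "perfect_matching V E M"
  shows "card V = 2 * card M"
proof -
  have ME: "M \<subseteq> E" using assms(2) by (simp add: perfect_matching_def)
  have U: "\<Union>M = V"
    using ME assms by (fastforce simp: sgraph_def elim: perfect_matchingE)
  have "finite M" using ME sgraph_simple_edges[OF assms(1)] finite_subset by blast
  then have "2 * card M = card (\<Union>M)"
  proof (rule card_partition)
    show "finite (\<Union>M)" using U assms(1) by (simp add: sgraph_def)
    show "card c = 2" if "c \<in> M" for c using that ME assms(1) by (auto simp: sgraph_def)
    show "c1 \<inter> c2 = {}" if "c1 \<in> M" "c2 \<in> M" "c1 \<noteq> c2" for c1 c2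
      using that perfect_matching_unique[OF assms(2)] U by blast
  qed
  with U show ?thesis by simp
qed

lemma sym_diff_cancel: "sym_diff M (sym_diff M N) = N"
  by blast

lemma even_card_alternating:
  assumes "simple_edges D" "alternating M D"
  shows "even (card D)"
proof -
  note c = card_perfect_matching[OF sgraph_Union[OF assms(1)]]
  have "card (\<Union>D) = 2 * card (D \<inter> M)" "card (\<Union>D) = 2 * card (D - M)"
    using assms(2) c by (auto simp: alternating_def)
  moreover have "card D = card (D \<inter> M) + card (D - M)"
    using assms(1) by (metis simple_edges_finite card_Int_Diff)
  ultimately show ?thesis by simp
qed

text \<open>At a vertex of D the edge of M lies in D, and the flip replaces it by the one edge of
  \<open>D - M\<close> there; other vertices keep their edge.\<close>

lemma perfect_matching_sym_diff:
  assumes M: "perfect_matching V E M" and "D \<subseteq> E" "alternating M D"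
  shows "perfect_matching V E (sym_diff M D)"
  unfolding perfect_matching_def
proof (intro conjI ballI)
  show "sym_diff M D \<subseteq> E" using assms by (auto simp: perfect_matching_def)
  fix v assume v: "v \<in> V"
  show "\<exists>!e. e \<in> sym_diff M D \<and> v \<in> e"
  proof (cases "v \<in> \<Union>D")
    case False
    then have "e \<in> sym_diff M D \<and> v \<in> e \<longleftrightarrow> e \<in> M \<and> v \<in> e" for e by blast
    then show ?thesis using M v by (simp add: perfect_matching_def)
  next
    case True
    then obtain f where f: "f \<in> D" "f \<in> M" "v \<in> f"
      using assms(3) by (auto simp: alternating_def elim: perfect_matchingE)
    have "\<exists>!e. e \<in> D - M \<and> v \<in> e"
      using assms(3) unfolding alternating_def by (intro perfect_matching_ex1[OF _ True]) (rule conjunct2)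
    moreover have "e \<in> sym_diff M D \<and> v \<in> e \<longleftrightarrow> e \<in> D - M \<and> v \<in> e" for e
      using perfect_matching_unique[OF M v _ _ f(2,3)] f(1) by blast
    ultimately show ?thesis by simp
  qed
qed

lemma alternating_sym_diff_self:
  assumes "alternating M D"
  shows "alternating (sym_diff M D) D"
proof -
  have "D \<inter> sym_diff M D = D - M" "D - sym_diff M D = D \<inter> M" by blast+
  with assms show ?thesis by (simp add: alternating_def)
qed

lemma is_cycle_matching_alternating:
  assumes "is_cycle C" "perfect_matching (\<Union>C) C (C \<inter> M)"
  shows "alternating M C"
proof -
  have "\<exists>!e. e \<in> C - M \<and> v \<in> e" if v: "v \<in> \<Union>C" for v
  proof -
    obtain e1 e2 where e: "edges_at C v = {e1, e2}" "e1 \<noteq> e2"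
      using is_cycle_edges_at[OF assms(1) v] by (meson card_2_iff)
    obtain f where f: "f \<in> C \<inter> M" "v \<in> f" "\<And>g. g \<in> C \<inter> M \<Longrightarrow> v \<in> g \<Longrightarrow> g = f"
      using assms(2) v unfolding perfect_matching_def by metis
    have C: "g \<in> C \<and> v \<in> g \<longleftrightarrow> g = e1 \<or> g = e2" for g using e(1) by (auto simp: edges_at_def)
    have g: "g \<in> C - M \<and> v \<in> g \<longleftrightarrow> (g = e1 \<or> g = e2) \<and> g \<noteq> f" for g
      using C[of g] f(1,2) f(3)[of g] by blast
    have "f = e1 \<or> f = e2" using f(1,2) C[of f] by blast
    then show ?thesis unfolding g using e(2) by metis
  qed
  then have "perfect_matching (\<Union>C) C (C - M)"
    unfolding perfect_matching_def by (intro conjI ballI Diff_subset)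
  with assms(2) show ?thesis unfolding alternating_def by (rule conjI)
qed

text \<open>Of the two edges of D at a vertex, N contains at most one, hence M at least one; and M,
  being a matching, at most one.\<close>

lemma alternating_subset_sym_diff:
  assumes M: "perfect_matching V E M" and N: "perfect_matching V E N" and V: "\<Union>E \<subseteq> V"
    and D: "D \<subseteq> sym_diff M N" "is_cycle D"
  shows "alternating M D"
proof (rule is_cycle_matching_alternating[OF D(2)])
  have "\<exists>!e. e \<in> D \<inter> M \<and> v \<in> e" if v: "v \<in> \<Union>D" for v
  proof -
    have "D \<subseteq> E" using D(1) M N unfolding perfect_matching_def by blast
    then have vV: "v \<in> V" using v V by blast
    obtain e1 e2 where e: "edges_at D v = {e1, e2}" "e1 \<noteq> e2"
      using is_cycle_edges_at[OF D(2) v] by (meson card_2_iff)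
    then have C: "g \<in> D \<and> v \<in> g \<longleftrightarrow> g = e1 \<or> g = e2" for g by (auto simp: edges_at_def)
    have "e1 \<in> M \<or> e2 \<in> M"
      using perfect_matching_unique[OF N vV, of e1 e2] C[of e1] C[of e2] e(2) D(1) by blast
    then obtain f where "f \<in> D" "f \<in> M" "v \<in> f" using C[of e1] C[of e2] by blast
    then show ?thesis using perfect_matching_unique[OF M vV] by blast
  qed
  then show "perfect_matching (\<Union>D) D (D \<inter> M)" by (auto simp: perfect_matching_def)
qed

text \<open>At a vertex where M and N differ each contributes an edge of its own, so all degrees in
  the symmetric difference are at least 2.\<close>

lemma exists_cycle_sym_diff:
  assumes E: "sgraph V E" and M: "perfect_matching V E M" and N: "perfect_matching V E N" and "M \<noteq> N"
  obtains D where "D \<subseteq> sym_diff M N" "is_cycle D"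
proof -
  let ?S = "sym_diff M N"
  have SE: "?S \<subseteq> E" using M N by (auto simp: perfect_matching_def)
  have S: "simple_edges ?S" using simple_edges_subset[OF sgraph_simple_edges[OF E] SE] .
  have "card (edges_at ?S v) \<ge> 2" if v: "v \<in> \<Union>?S" for v
  proof -
    have vV: "v \<in> V" using v SE E by (auto simp: sgraph_def)
    obtain f where f: "f \<in> M" "v \<in> f" using M vV by (auto elim: perfect_matchingE)
    obtain g where g: "g \<in> N" "v \<in> g" using N vV by (auto elim: perfect_matchingE)
    have "f \<noteq> g"
      using v f g perfect_matching_unique[OF M vV] perfect_matching_unique[OF N vV] by blast
    moreover have "{f, g} \<subseteq> edges_at ?S v"
      using \<open>f \<noteq> g\<close> f g perfect_matching_unique[OF M vV] perfect_matching_unique[OF N vV]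
      unfolding edges_at_def by blast
    ultimately show ?thesis
      using card_mono[of "edges_at ?S v" "{f, g}"] S by auto
  qed
  moreover have "?S \<noteq> {}" using \<open>M \<noteq> N\<close> by blast
  ultimately obtain vs where "distinct vs" "length vs \<ge> 3" "cyc_edges vs \<subseteq> ?S"
    using exists_cycle_list[OF S] by blast
  then show thesis using that is_cycle_cyc_edges by blast
qed

text \<open>M matches the vertices of D inside D, so its remaining edges match the rest of the
  graph.\<close>

lemma nice_cycle_alternating:
  assumes M: "perfect_matching V E M" and "D \<subseteq> E" "is_cycle D" "alternating M D" "\<Union>E \<subseteq> V"
  shows "nice_cycle V E D"
proof -
  have "perfect_matching (V - \<Union>D) {e\<in>E. e \<inter> \<Union>D = {}} {e\<in>M. e \<inter> \<Union>D = {}}"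
    unfolding perfect_matching_def
  proof (intro conjI ballI)
    show "{e \<in> M. e \<inter> \<Union>D = {}} \<subseteq> {e \<in> E. e \<inter> \<Union>D = {}}" using M by (auto simp: perfect_matching_def)
    fix v assume v: "v \<in> V - \<Union>D"
    then obtain f where f: "f \<in> M" "v \<in> f" using M by (auto elim: perfect_matchingE)
    have "f \<inter> \<Union>D = {}"
    proof (rule ccontr)
      assume "f \<inter> \<Union>D \<noteq> {}"
      then obtain u where u: "u \<in> f" "u \<in> \<Union>D" by blast
      then obtain h where "h \<in> D \<inter> M" "u \<in> h"
        using assms(4) by (auto simp: alternating_def elim: perfect_matchingE)
      moreover have "u \<in> V" using u assms(2,5) by blast
      ultimately have "h = f" using perfect_matching_unique[OF M] f u by blast
      then show False using \<open>h \<in> D \<inter> M\<close> f v by blast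
    qed
    with f show "\<exists>!e. e \<in> {e \<in> M. e \<inter> \<Union>D = {}} \<and> v \<in> e"
      using perfect_matching_unique[OF M] v by blast
  qed
  then show ?thesis using assms unfolding nice_cycle_def cycle_of_def by blast
qed

text \<open>The first, third, fifth, ... edge of the path: a perfect matching of it when the number
  of vertices is even.\<close>

fun every_other :: "'v list \<Rightarrow> 'v set set" where
  "every_other (x # y # zs) = insert {x, y} (every_other zs)"
| "every_other _ = {}"

lemma every_other_subset: "every_other vs \<subseteq> path_edges vs"
proof (induction vs rule: every_other.induct)
  case (1 x y zs) then show ?case by (cases zs) auto
qed auto

lemma perfect_matching_every_other:
  "distinct vs \<Longrightarrow> even (length vs) \<Longrightarrow> v \<in> set vs \<Longrightarrow> \<exists>!e. e \<in> every_other vs \<and> v \<in> e"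
proof (induction vs rule: every_other.induct)
  case (1 x y zs)
  have zs: "\<Union>(every_other zs) \<subseteq> set zs"
    using every_other_subset Union_path_edges_subset by (metis Union_mono order_trans)
  show ?case
  proof (cases "v \<in> {x, y}")
    case True
    then have "v \<notin> \<Union>(every_other zs)" using zs "1.prems"(1) by auto
    then show ?thesis using True by auto
  next
    case False
    then have "\<exists>!e. e \<in> every_other zs \<and> v \<in> e" using 1 by simp
    then show ?thesis using False by auto
  qed
qed auto

text \<open>The rest of the graph and, by \<open>M0\<close>, the whole graph have evenly many
  vertices. So C has even length, and every second edge of C completes the matching of the
  rest.\<close>

lemma nice_cycle_exists_alternating:
  assumes E: "sgraph V E" and pm: "perfect_matching V E M0" and C: "nice_cycle V E C"
  obtains M where "perfect_matching V E M" "alternating M C"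
proof -
  have CE: "C \<subseteq> E" and cyc: "is_cycle C" using C by (auto simp: nice_cycle_def cycle_of_def)
  obtain N where N: "perfect_matching (V - \<Union>C) {e\<in>E. e \<inter> \<Union>C = {}} N"
    using C by (auto simp: nice_cycle_def)
  have S: "simple_edges C" using simple_edges_subset[OF sgraph_simple_edges[OF E] CE] .
  obtain vs where vs: "distinct vs" "length vs \<ge> 3" "C = cyc_edges vs" using is_cycle_list[OF S cyc] .
  have U: "\<Union>C = set vs" unfolding vs(3) by (rule Union_cyc_edges) (use vs(2) in simp)
  have UV: "\<Union>C \<subseteq> V" using CE E by (auto simp: sgraph_def)
  have "sgraph (V - \<Union>C) {e\<in>E. e \<inter> \<Union>C = {}}" using E by (auto simp: sgraph_def)
  then have "even (card (V - \<Union>C))" using card_perfect_matching N by (metis dvd_triv_left)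
  moreover have "even (card V)" using card_perfect_matching[OF E pm] by simp
  moreover have "card V = card (V - \<Union>C) + card (\<Union>C)"
    using UV E by (metis sgraph_def card_Diff_subset card_mono finite_subset le_add_diff_inverse2)
  ultimately have ev: "even (length vs)" using U vs(1) by (simp add: distinct_card)
  define F where "F = every_other vs"
  have FC: "F \<subseteq> C" using every_other_subset[of vs] by (auto simp: F_def vs(3) cyc_edges_def)
  have NC: "e \<inter> \<Union>C = {}" if "e \<in> N" for e using N that by (auto simp: perfect_matching_def)
  have F1: "\<exists>!e. e \<in> F \<and> v \<in> e" if "v \<in> \<Union>C" for v
    unfolding F_def by (rule perfect_matching_every_other) (use that vs(1) ev U in auto)
  have "C \<inter> (N \<union> F) = F"
  proof -
    have "e \<notin> N" if "e \<in> C" for e using NC[of e] that simple_edges_nonempty[OF S that] by blast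
    then show ?thesis using FC by blast
  qed
  then have "alternating (N \<union> F) C"
    using F1 FC by (intro is_cycle_matching_alternating cyc) (simp add: perfect_matching_def)
  moreover have "perfect_matching V E (N \<union> F)"
    unfolding perfect_matching_def
  proof (intro conjI ballI)
    show "N \<union> F \<subseteq> E" using N FC CE by (auto simp: perfect_matching_def)
    fix v assume v: "v \<in> V"
    show "\<exists>!e. e \<in> N \<union> F \<and> v \<in> e"
    proof (cases "v \<in> \<Union>C")
      case True
      then have "e \<in> N \<union> F \<and> v \<in> e \<longleftrightarrow> e \<in> F \<and> v \<in> e" for e using NC by blast
      then show ?thesis using F1[OF True] by simp
    next
      case False
      then have "e \<in> N \<union> F \<and> v \<in> e \<longleftrightarrow> e \<in> N \<and> v \<in> e" for e using FC by blast
      then show ?thesis using N v False by (simp add: perfect_matching_def)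
    qed
  qed
  ultimately show thesis using that by blast
qed

text \<open>All cycles flipped lie in the initial \<open>sym_diff P Q\<close>, because a flip only
  removes its cycle from the difference. This bound lets \<open>flip_cycle\<close> rule out C
  itself.\<close>

lemma flips_connect:
  assumes E: "sgraph V E" and P: "perfect_matching V E P" and Q: "perfect_matching V E Q"
    and flip: "\<And>M D. perfect_matching V E M \<Longrightarrow> D \<subseteq> sym_diff P Q \<Longrightarrow> is_cycle D \<Longrightarrow>
      alternating M D \<Longrightarrow> R\<^sup>*\<^sup>* M (sym_diff M D)"
  shows "R\<^sup>*\<^sup>* P Q"
  using P flip
proof (induction "card (sym_diff P Q)" arbitrary: P rule: less_induct)
  case less
  have EV: "\<Union>E \<subseteq> V" using E by (auto simp: sgraph_def)
  show ?case
  proof (cases "P = Q")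
    case False
    then obtain D where D: "D \<subseteq> sym_diff P Q" "is_cycle D"
      using exists_cycle_sym_diff[OF E less.prems(1) Q] by blast
    have alt: "alternating P D" using alternating_subset_sym_diff[OF less.prems(1) Q EV D] .
    have SE: "sym_diff P Q \<subseteq> E" using less.prems(1) Q by (auto simp: perfect_matching_def)
    then have DE: "D \<subseteq> E" using D(1) by (rule order_trans[rotated])
    let ?P = "sym_diff P D"
    have eq: "sym_diff ?P Q = sym_diff P Q - D" using D(1) by blast
    have "D \<noteq> {}" using D(2) by (auto simp: is_cycle_def)
    have fin: "finite (sym_diff P Q)"
      using finite_subset[OF SE] sgraph_simple_edges[OF E] by blast
    have "card (sym_diff ?P Q) < card (sym_diff P Q)"
      unfolding eq by (rule psubset_card_mono[OF fin]) (use D(1) \<open>D \<noteq> {}\<close> in blast)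
    moreover have "perfect_matching V E ?P" by (rule perfect_matching_sym_diff[OF less.prems(1) DE alt])
    moreover have "R\<^sup>*\<^sup>* M (sym_diff M D')"
      if "perfect_matching V E M" "D' \<subseteq> sym_diff ?P Q" "is_cycle D'" "alternating M D'" for M D'
      by (rule less.prems(2)[OF that(1) _ that(3,4)]) (use that(2) eq in blast)
    ultimately have "R\<^sup>*\<^sup>* ?P Q" by (rule less.hyps)
    moreover have "R\<^sup>*\<^sup>* P ?P" by (rule less.prems(2)[OF less.prems(1) D alt])
    ultimately show ?thesis by (rule rtranclp_trans[rotated])
  qed simp
qed

section \<open>Bipartite graphs\<close>

text \<open>Sending a vertex to its partner maps \<open>Z \<inter> A\<close> injectively into
  \<open>Z - A\<close>. Equal sizes make the map onto, so the vertices of \<open>Z - A\<close> are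
  matched inside Z, too. M may be a matching of a larger graph: only its edges at
  \<open>Z \<inter> A\<close> are constrained.\<close>

lemma matching_closed_of_neighbours:
  assumes fin: "finite Z" and M: "\<And>v. v \<in> Z \<Longrightarrow> \<exists>!e. e \<in> M \<and> v \<in> e"
    and card: "card (Z \<inter> A) = card (Z - A)"
    and nb: "\<And>e. e \<in> M \<Longrightarrow> e \<inter> (Z \<inter> A) \<noteq> {} \<Longrightarrow> e \<subseteq> Z \<and> card (e \<inter> A) = 1 \<and> card (e - A) = 1"
    and e: "e \<in> M" "e \<inter> Z \<noteq> {}"
  shows "e \<subseteq> Z"
proof -
  define m where "m v = (THE e. e \<in> M \<and> v \<in> e)" for v
  have m: "m v \<in> M" "v \<in> m v" if "v \<in> Z" for v
    using theI'[OF M[OF that]] by (auto simp: m_def)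
  have m_eq: "m v = e" if "v \<in> Z" "e \<in> M" "v \<in> e" for v e
    using M[OF that(1)] m[OF that(1)] that by blast
  define f where "f v = the_elem (m v - A)" for v
  have f: "m v - A = {f v}" if "v \<in> Z \<inter> A" for v
  proof -
    have "card (m v - A) = 1" using nb[of "m v"] m[of v] that by blast
    then show ?thesis unfolding f_def by (metis card_1_singletonE the_elem_eq)
  qed
  have fm: "f v \<in> m v" "f v \<in> Z - A" if "v \<in> Z \<inter> A" for v
    using f[OF that] nb[of "m v"] m[of v] that by blast+
  have "inj_on f (Z \<inter> A)"
  proof (rule inj_onI)
    fix x y assume xy: "x \<in> Z \<inter> A" "y \<in> Z \<inter> A" "f x = f y"
    have "m x = m (f x)" using m_eq[of "f x" "m x"] fm[OF xy(1)] m[of x] xy(1) by simp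
    moreover have "m y = m (f x)" using m_eq[of "f y" "m y"] fm[OF xy(2)] m[of y] xy by simp
    ultimately have "{x, y} \<subseteq> m x \<inter> A" using m[of x] m[of y] xy by auto
    moreover have "card (m x \<inter> A) = 1" using nb[of "m x"] m[of x] xy by blast
    ultimately show "x = y" by (metis card_1_singletonE insert_subset singletonD)
  qed
  then have "f ` (Z \<inter> A) = Z - A"
    using card fm(2) fin by (intro card_subset_eq) (auto simp: card_image)
  obtain z where z: "z \<in> e" "z \<in> Z" using e(2) by blast
  show ?thesis
  proof (cases "z \<in> A")
    case True then show ?thesis using nb[OF e(1)] z by blast
  next
    case False
    then obtain v where v: "v \<in> Z \<inter> A" "z = f v" using \<open>f ` (Z \<inter> A) = Z - A\<close> z by blast
    then have "e = m v" using m_eq[OF z(2) e(1) z(1)] m_eq[OF z(2), of "m v"] fm[OF v(1)] m[of v] by simp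
    then show ?thesis using nb[of "m v"] m[of v] v(1) by blast
  qed
qed

lemma rtranclp_distinct_path:
  assumes "R\<^sup>*\<^sup>* a b"
  obtains vs where "vs \<noteq> []" "hd vs = a" "last vs = b" "distinct vs" "successively R vs"
proof -
  have "\<exists>vs. vs \<noteq> [] \<and> hd vs = a \<and> last vs = b \<and> distinct vs \<and> successively R vs"
    using assms
  proof (induction rule: converse_rtranclp_induct)
    case base
    show ?case by (rule exI[of _ "[b]"]) simp
  next
    case (step y z)
    then obtain vs where vs: "vs \<noteq> []" "hd vs = z" "last vs = b" "distinct vs" "successively R vs" by blast
    show ?case
    proof (cases "y \<in> set vs")
      case True
      then obtain xs ys where "vs = xs @ y # ys" by (meson split_list)
      then show ?thesis using vs by (intro exI[of _ "y # ys"]) (auto simp: successively_append_iff)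
    next
      case False
      then show ?thesis using vs step(1)
        by (intro exI[of _ "y # vs"]) (auto simp: successively_Cons)
    qed
  qed
  with that show thesis by blast
qed

section \<open>Allowed edges and balanced cuts\<close>

definition bicoloured :: "'v set \<Rightarrow> 'v set set \<Rightarrow> bool" where
  "bicoloured A E \<longleftrightarrow> (\<forall>e\<in>E. card (e \<inter> A) = 1 \<and> card (e - A) = 1)"

lemma bipartite_iff: "bipartite V E \<longleftrightarrow> (\<exists>A\<subseteq>V. bicoloured A E)"
  by (auto simp: bipartite_def bicoloured_def)

lemma bicoloured_edge: "bicoloured A E \<Longrightarrow> {u, v} \<in> E \<Longrightarrow> u \<in> A \<longleftrightarrow> v \<notin> A"
proof -
  assume "bicoloured A E" "{u, v} \<in> E"
  then have "card ({u, v} \<inter> A) = 1" "card ({u, v} - A) = 1" unfolding bicoloured_def by blast+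
  then show ?thesis by (cases "u \<in> A"; cases "v \<in> A"; cases "u = v") auto
qed

text \<open>Z is a disjoint union of edges of M, each with one end of either colour.\<close>

lemma perfect_matching_balanced:
  assumes E: "sgraph V E" and A: "bicoloured A E" and M: "perfect_matching V E M"
    and Z: "Z \<subseteq> V" "\<And>e. e \<in> M \<Longrightarrow> e \<inter> Z \<noteq> {} \<Longrightarrow> e \<subseteq> Z"
  shows "card (Z \<inter> A) = card (Z - A)"
proof -
  define N where "N = {e \<in> M. e \<subseteq> Z}"
  have NE: "N \<subseteq> E" using M by (auto simp: N_def perfect_matching_def)
  have fN: "finite N" using finite_subset[OF NE] sgraph_simple_edges[OF E] by blast
  have fe: "finite e" if "e \<in> N" for e using that NE E by (metis sgraph_def card.infinite subsetD zero_neq_numeral)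
  have U: "Z = \<Union>N"
  proof
    show "Z \<subseteq> \<Union>N"
    proof
      fix v assume "v \<in> Z"
      then obtain e where "e \<in> M" "v \<in> e" using M Z(1) by (auto elim: perfect_matchingE)
      then show "v \<in> \<Union>N" using Z(2)[of e] \<open>v \<in> Z\<close> by (auto simp: N_def)
    qed
  qed (auto simp: N_def)
  have disj: "e \<inter> f = {}" if "e \<in> N" "f \<in> N" "e \<noteq> f" for e f
    using that perfect_matching_unique[OF M] Z(1) unfolding N_def by blast
  have "card (\<Union>e\<in>N. e \<inter> A) = (\<Sum>e\<in>N. card (e \<inter> A))"
    by (rule card_UN_disjoint) (use fN fe disj in blast)+
  also have "\<dots> = (\<Sum>e\<in>N. card (e - A))"
    using A NE by (intro sum.cong) (auto simp: bicoloured_def)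
  also have "\<dots> = card (\<Union>e\<in>N. e - A)"
    by (rule card_UN_disjoint[symmetric]) (use fN fe disj in blast)+
  moreover have "(\<Union>e\<in>N. e \<inter> A) = Z \<inter> A" "(\<Union>e\<in>N. e - A) = Z - A" unfolding U by blast+
  ultimately show ?thesis by simp
qed

text \<open>Orient the edges of M towards A and the other edges away from A.  An edge ab that is not allowed
  lies on no directed cycle; Z is the set of vertices reachable from b.\<close>

lemma not_allowed_cut:
  assumes E: "sgraph V E" and A: "bicoloured A E" and M: "perfect_matching V E M"
    and ab: "{a, b} \<in> E" "a \<in> A" "\<not> allowed_edge V E {a, b}"
  obtains Z where "Z \<subseteq> V" "b \<in> Z" "a \<notin> Z" "card (Z \<inter> A) = card (Z - A)"
    "\<And>e. e \<in> E \<Longrightarrow> e \<inter> (Z \<inter> A) \<noteq> {} \<Longrightarrow> e \<subseteq> Z"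
proof -
  define st where "st u v \<longleftrightarrow> {u, v} \<in> E \<and> ({u, v} \<in> M \<longleftrightarrow> u \<notin> A)" for u v
  have S: "simple_edges E" using sgraph_simple_edges[OF E] .
  have ME: "M \<subseteq> E" using M by (simp add: perfect_matching_def)
  have bA: "b \<notin> A" using bicoloured_edge[OF A ab(1)] ab(2) by simp
  have abM: "{a, b} \<notin> M" using ab(3) M by (auto simp: allowed_edge_def)
  have stA: "st u v \<Longrightarrow> u \<in> A \<longleftrightarrow> v \<notin> A" for u v using bicoloured_edge[OF A] by (auto simp: st_def)
  have stV: "st u v \<Longrightarrow> v \<in> V" for u v using E by (auto simp: st_def sgraph_def)
  define Z where "Z = {z. st\<^sup>*\<^sup>* b z}"
  have bV: "b \<in> V" using ab(1) E by (auto simp: sgraph_def)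
  have ZV: "Z \<subseteq> V"
  proof
    fix z assume "z \<in> Z"
    then have "st\<^sup>*\<^sup>* b z" by (simp add: Z_def)
    then show "z \<in> V" by (induction rule: rtranclp_induct) (use bV stV in auto)
  qed
  have step: "v \<in> Z" if "u \<in> Z" "st u v" for u v
    using that unfolding Z_def by (auto intro: rtranclp.rtrancl_into_rtrancl)
  have bZ: "b \<in> Z" by (simp add: Z_def)
  have "a \<notin> Z"
  proof
    assume "a \<in> Z"
    then have "st\<^sup>*\<^sup>* b a" by (simp add: Z_def)
    then obtain vs where vs: "vs \<noteq> []" "hd vs = b" "last vs = a" "distinct vs" "successively st vs"
      by (rule rtranclp_distinct_path)
    have stab: "st a b" using ab abM by (simp add: st_def)
    have "length vs \<ge> 3"
    proof (rule ccontr)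
      assume "\<not> length vs \<ge> 3"
      moreover have "length vs > 0" using vs(1) by simp
      ultimately consider "length vs = 1" | "length vs = 2" by linarith
      then show False
      proof cases
        case 1 then show False using vs(2,3) ab(2) bA by (cases vs) auto
      next
        case 2
        then obtain x y where "vs = [x, y]" by (metis length_0_conv length_Suc_conv numeral_2_eq_2)
        then have "st b a" using vs by simp
        then show False using abM bA by (auto simp: st_def insert_commute)
      qed
    qed
    \<comment> \<open>The step from a to b closes the path to a directed cycle. Consecutive directed
      steps alternate between M and its complement, so flipping D gives a perfect matching that
      contains ab.\<close>
    define D where "D = cyc_edges vs"
    have cyc: "is_cycle D" using is_cycle_cyc_edges vs(4) \<open>length vs \<ge> 3\<close> D_def by blast
    have DE: "D \<subseteq> E"
    proof -
      have "path_edges vs \<subseteq> E"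
        using vs(5) by (subst successively_iff_path_edges[symmetric]) (auto elim: successively_mono simp: st_def)
      then show ?thesis using ab(1) vs(2,3) by (simp add: D_def cyc_edges_def)
    qed
    have "\<exists>!e. e \<in> D \<inter> M \<and> v \<in> e" if v: "v \<in> \<Union>D" for v
    proof -
      have U: "\<Union>D = set vs" unfolding D_def by (rule Union_cyc_edges) (use \<open>length vs \<ge> 3\<close> in simp)
      then have "v \<in> set vs" using v by simp
      then obtain xs ys w zs where s: "vs = xs @ ys" "ys @ xs = v # w # zs" "zs \<noteq> []"
        using split_at_vertex \<open>length vs \<ge> 3\<close> by metis
      have dist: "distinct (v # w # zs)" using s vs(4) by (metis distinct_append inf_commute)
      have DC: "D = cyc_edges (v # w # zs)" using s cyc_edges_rotate D_def by metis
      have st: "successively st (ys @ xs) \<and> st (last (ys @ xs)) (hd (ys @ xs))"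
      proof (cases "xs = [] \<or> ys = []")
        case True
        then show ?thesis using vs stab s(1) by auto
      next
        case False
        then show ?thesis using vs stab s(1) by (auto simp: successively_append_iff)
      qed
      then have st: "st v w" "st (last zs) v" using s(2,3) by auto
      have "edges_at D v = {{last zs, v}, {v, w}}" using edges_at_cyc_edges_Cons[OF dist s(3)] DC by simp
      then have g: "g \<in> D \<inter> M \<and> v \<in> g \<longleftrightarrow> (g = {last zs, v} \<or> g = {v, w}) \<and> g \<in> M" for g
        by (auto simp: edges_at_def)
      have "{v, w} \<in> M \<longleftrightarrow> {last zs, v} \<notin> M"
        using st stA[OF st(2)] by (auto simp: st_def)
      then show ?thesis unfolding g by metis
    qed
    then have "perfect_matching (\<Union>D) D (D \<inter> M)" by (simp add: perfect_matching_def)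
    then have "perfect_matching V E (sym_diff M D)"
      using is_cycle_matching_alternating[OF cyc] perfect_matching_sym_diff[OF M DE] by blast
    moreover have "{a, b} \<in> sym_diff M D" using abM vs(2,3) by (simp add: D_def cyc_edges_def)
    ultimately show False using ab(3) by (auto simp: allowed_edge_def)
  qed
  \<comment> \<open>A vertex of A is entered only along edges of M, and b is not in A; so every
    vertex of \<open>Z \<inter> A\<close> has its partner in Z.\<close>
  have pred: "\<exists>u\<in>Z. {u, v} \<in> M" if v: "v \<in> Z" "v \<in> A" for v
  proof -
    have "st\<^sup>*\<^sup>* b v" using v by (simp add: Z_def)
    then obtain u where u: "st\<^sup>*\<^sup>* b u" "st u v" using v bA by (metis rtranclp.cases)
    then have "u \<notin> A" using stA v(2) by blast
    then show ?thesis using u by (auto simp: Z_def st_def)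
  qed
  have nb: "e \<subseteq> Z" if e: "e \<in> E" "e \<inter> (Z \<inter> A) \<noteq> {}" for e
  proof -
    obtain v where v: "v \<in> e" "v \<in> Z" "v \<in> A" using e(2) by blast
    obtain w where w: "e = {v, w}" "w \<noteq> v" using simple_edgesE[OF S e(1) v(1)] .
    show ?thesis
    proof (cases "e \<in> M")
      case True
      obtain u where "u \<in> Z" "{u, v} \<in> M" using pred v by blast
      then have "{u, v} = e"
        using perfect_matching_unique[OF M _ _ _ True, of v "{u, v}"] v ZV by blast
      then show ?thesis using \<open>u \<in> Z\<close> v(2) by blast
    next
      case False
      then have "st v w" using e w v by (simp add: st_def)
      then show ?thesis using step v w by blast
    qed
  qed
  \<comment> \<open>From a vertex outside A its edge of M is itself a directed step. So M does not
    cross Z, which makes Z balanced.\<close>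
  have "e \<subseteq> Z" if e: "e \<in> M" "e \<inter> Z \<noteq> {}" for e
  proof -
    obtain v where v: "v \<in> e" "v \<in> Z" using e(2) by blast
    obtain w where w: "e = {v, w}" "w \<noteq> v" using simple_edgesE[OF S _ v(1)] e(1) ME by blast
    show ?thesis
    proof (cases "v \<in> A")
      case True
      then show ?thesis using nb[of e] e ME v by blast
    next
      case False
      then have "st v w" using e w ME by (auto simp: st_def)
      then show ?thesis using step v w by blast
    qed
  qed
  then have "card (Z \<inter> A) = card (Z - A)" by (rule perfect_matching_balanced[OF E A M ZV])
  with that ZV bZ \<open>a \<notin> Z\<close> nb show thesis by blast
qed

text \<open>Otherwise e crosses a balanced set Z. Connectedness of the allowed edges yields a
  perfect matching with an edge crossing Z, which the count in
  \<open>matching_closed_of_neighbours\<close> forbids.\<close>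

lemma elementary_bipartite_allowed:
  assumes E: "sgraph V E" and A: "bicoloured A E" and el: "elementary V E" and e: "e \<in> E"
  shows "allowed_edge V E e"
proof (rule ccontr)
  assume na: "\<not> allowed_edge V E e"
  obtain M where M: "perfect_matching V E M" using el by (auto simp: elementary_def)
  have "card (e \<inter> A) = 1" "card e = 2" using A E e by (auto simp: bicoloured_def sgraph_def)
  then obtain a where "a \<in> e" "a \<in> A" by (metis Int_iff card_1_singletonE insertI1)
  then obtain b where ab: "e = {a, b}" using simple_edgesE[OF sgraph_simple_edges[OF E] e] by metis
  obtain Z where Z: "Z \<subseteq> V" "b \<in> Z" "a \<notin> Z" "card (Z \<inter> A) = card (Z - A)"
    and nb: "\<And>e. e \<in> E \<Longrightarrow> e \<inter> (Z \<inter> A) \<noteq> {} \<Longrightarrow> e \<subseteq> Z"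
    by (rule not_allowed_cut[OF E A M, of a b]) (use e na ab \<open>a \<in> A\<close> in auto)
  have "b \<in> V" "a \<in> V" using E e ab by (auto simp: sgraph_def)
  then obtain u v where uv: "{u, v} \<in> {e \<in> E. allowed_edge V E e}" "u \<in> Z" "v \<notin> Z"
    using el graph_connected_cut[of V _ b a Z] Z(2,3) unfolding elementary_def by metis
  then obtain N where N: "perfect_matching V E N" "{u, v} \<in> N" by (auto simp: allowed_edge_def)
  have "finite Z" using Z(1) E by (auto simp: sgraph_def intro: finite_subset)
  then have "{u, v} \<subseteq> Z"
  proof (rule matching_closed_of_neighbours[OF _ _ Z(4)])
    show "\<exists>!e. e \<in> N \<and> w \<in> e" if "w \<in> Z" for w using perfect_matching_ex1[OF N(1)] that Z(1) by blast
    show "f \<subseteq> Z \<and> card (f \<inter> A) = 1 \<and> card (f - A) = 1" if "f \<in> N" "f \<inter> (Z \<inter> A) \<noteq> {}" for f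
    proof -
      have "f \<in> E" using N(1) that(1) by (auto simp: perfect_matching_def)
      then show ?thesis using nb[OF _ that(2)] A by (auto simp: bicoloured_def)
    qed
  qed (use N uv in auto)
  with uv show False by blast
qed

text \<open>The last argument collects the edges that a walk from r uses an odd number of times. Its
  size has the parity of the length of the walk, and only the two ends, if different, have odd
  degree in it.\<close>

inductive parity_walk :: "'v set set \<Rightarrow> 'v \<Rightarrow> 'v \<Rightarrow> 'v set set \<Rightarrow> bool" for E r where
  nil: "parity_walk E r r {}"
| snoc: "parity_walk E r u S \<Longrightarrow> {u, v} \<in> E \<Longrightarrow> parity_walk E r v (sym_diff S {{u, v}})"

lemma parity_walk_subset: "parity_walk E r v S \<Longrightarrow> S \<subseteq> E"
  by (induction rule: parity_walk.induct) auto

lemma parity_walk_degree: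
  assumes "parity_walk E r v S" "simple_edges E"
  shows "odd (card (edges_at S x)) \<longleftrightarrow> (x = r) \<noteq> (x = v)"
  using assms(1)
proof (induction rule: parity_walk.induct)
  case nil
  then show ?case by (simp add: edges_at_def)
next
  case (snoc u S v)
  have "finite S" using parity_walk_subset[OF snoc(1)] assms(2) finite_subset by blast
  moreover have "card {u, v} = 2" using assms(2) snoc(2) by (simp add: simple_edges_def)
  then have "u \<noteq> v" by auto
  moreover have "edges_at {{u, v}} x = (if x = u \<or> x = v then {{u, v}} else {})" by (auto simp: edges_at_def)
  ultimately show ?case using snoc(3) by (auto simp: edges_at_sym_diff odd_card_sym_diff)
qed

lemma parity_walk_reach: "(\<lambda>x y. {x, y} \<in> E)\<^sup>*\<^sup>* r v \<Longrightarrow> \<exists>S. parity_walk E r v S"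
  by (induction rule: rtranclp_induct) (blast intro: parity_walk.intros)+

text \<open>Colour a vertex by the parity of a walk from r. Two walks of different parity to one
  vertex would differ by an edge set of odd size with even degrees, which contains an odd
  cycle.\<close>

lemma bipartite_if_no_odd_cycle:
  assumes E: "sgraph V E" and con: "graph_connected V E"
    and even: "\<And>D. D \<subseteq> E \<Longrightarrow> is_cycle D \<Longrightarrow> even (card D)"
  shows "bipartite V E"
proof (cases "V = {}")
  case True
  then have "E = {}" using E by (fastforce simp: sgraph_def)
  then show ?thesis by (auto simp: bipartite_def)
next
  case False
  then obtain r where r: "r \<in> V" by blast
  have S: "simple_edges E" using sgraph_simple_edges[OF E] .
  have par: "even (card S) \<longleftrightarrow> even (card S')" if "parity_walk E r v S" "parity_walk E r v S'" for v S S'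
  proof (rule ccontr)
    have sub: "S \<subseteq> E" "S' \<subseteq> E" using that by (simp_all add: parity_walk_subset)
    then have fin: "finite S" "finite S'" using S finite_subset by blast+
    assume "\<not> ?thesis"
    then have "odd (card (sym_diff S S'))" using fin by (simp add: odd_card_sym_diff)
    moreover have "even (card (edges_at (sym_diff S S') x))" for x
    proof -
      have "odd (card (edges_at S x)) \<longleftrightarrow> odd (card (edges_at S' x))"
        using parity_walk_degree[OF that(1) S, of x] parity_walk_degree[OF that(2) S, of x] by simp
      then show ?thesis
        using odd_card_sym_diff[of "edges_at S x" "edges_at S' x"] fin by (simp add: edges_at_sym_diff)
    qed
    moreover have "simple_edges (sym_diff S S')" by (rule simple_edges_subset[OF S]) (use sub in blast)
    ultimately obtain D where "D \<subseteq> sym_diff S S'" "is_cycle D" "odd (card D)"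
      using exists_odd_cycle[of "sym_diff S S'"] by blast
    then show False using even[of D] sub by blast
  qed
  define A where "A = {v \<in> V. \<exists>S. parity_walk E r v S \<and> even (card S)}"
  have "card (e \<inter> A) = 1 \<and> card (e - A) = 1" if e: "e \<in> E" for e
  proof -
    obtain u v where uv: "e = {u, v}" "u \<noteq> v" using E e unfolding sgraph_def card_2_iff by metis
    have V: "u \<in> V" "v \<in> V" using E e uv by (auto simp: sgraph_def)
    obtain S where Su: "parity_walk E r u S" using parity_walk_reach con r V by (metis graph_connected_def)
    then have Sv: "parity_walk E r v (sym_diff S {{u, v}})" using parity_walk.snoc e uv by metis
    have "finite S" using parity_walk_subset[OF Su] \<open>simple_edges E\<close> finite_subset by blast
    then have "odd (card (sym_diff S {{u, v}})) \<longleftrightarrow> even (card S)" by (simp add: odd_card_sym_diff)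
    then have "u \<in> A \<longleftrightarrow> v \<notin> A"
      using par[OF Su] par[OF Sv] Su Sv V unfolding A_def by blast
    then have "e \<inter> A = {u} \<and> e - A = {v} \<or> e \<inter> A = {v} \<and> e - A = {u}" using uv by auto
    then show ?thesis by (elim disjE conjE) simp_all
  qed
  moreover have "A \<subseteq> V" by (auto simp: A_def)
  ultimately show ?thesis unfolding bipartite_def by blast
qed

section \<open>Cycles as closed curves\<close>

lemma plane_graph_sgraph: "plane_graph V E \<gamma> \<Longrightarrow> sgraph V E"
  unfolding plane_graph_def sgraph_def card_2_iff by (metis bot.extremum insert_subset)

lemma plane_graph_arc: "plane_graph V E \<gamma> \<Longrightarrow> e \<in> E \<Longrightarrow> arc (\<gamma> e)"
  by (simp add: plane_graph_def)

lemma plane_graph_ends: "plane_graph V E \<gamma> \<Longrightarrow> e \<in> E \<Longrightarrow> {pathstart (\<gamma> e), pathfinish (\<gamma> e)} = e"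
  by (simp add: plane_graph_def)

lemma plane_graph_vertices: "plane_graph V E \<gamma> \<Longrightarrow> e \<in> E \<Longrightarrow> path_image (\<gamma> e) \<inter> V = e"
  by (simp add: plane_graph_def)

lemma plane_graph_Int:
  "plane_graph V E \<gamma> \<Longrightarrow> e \<in> E \<Longrightarrow> e' \<in> E \<Longrightarrow> e \<noteq> e' \<Longrightarrow>
    path_image (\<gamma> e) \<inter> path_image (\<gamma> e') = e \<inter> e'"
  unfolding plane_graph_def by blast

lemma edge_subset_image: "plane_graph V E \<gamma> \<Longrightarrow> e \<in> E \<Longrightarrow> e \<subseteq> path_image (\<gamma> e)"
  using plane_graph_vertices by blast

lemma drawing_mono: "C \<subseteq> D \<Longrightarrow> drawing \<gamma> C \<subseteq> drawing \<gamma> D"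
  by (auto simp: drawing_def)

lemma image_subset_drawing: "e \<in> C \<Longrightarrow> path_image (\<gamma> e) \<subseteq> drawing \<gamma> C"
  by (auto simp: drawing_def)

lemma drawing_insert: "drawing \<gamma> (insert e C) = path_image (\<gamma> e) \<union> drawing \<gamma> C"
  by (simp add: drawing_def)

lemma compact_drawing:
  assumes "plane_graph V E \<gamma>" "D \<subseteq> E"
  shows "compact (drawing \<gamma> D)"
proof -
  have "finite D" using sgraph_simple_edges[OF plane_graph_sgraph[OF assms(1)]] assms(2) finite_subset by blast
  then show ?thesis unfolding drawing_def
    by (rule compact_UN) (use assms plane_graph_arc compact_arc_image in blast)
qed

text \<open>A branch of the logarithm, scaled so that a full turn counts 1. Its jumps are harmless:
  only its values at vertices are used, and these cancel along a closed curve.\<close>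

definition arg_about :: "complex \<Rightarrow> complex \<Rightarrow> complex" where
  "arg_about z v = Ln (v - z) / (2 * pi * \<i>)"

text \<open>The integer k is, informally, the signed number of crossings of the edge with the branch
  cut to the left of z. Reversing the edge negates k, so its parity does not depend on the direction
  in which the edge is drawn.\<close>

definition odd_edges ::
  "complex set set \<Rightarrow> (complex set \<Rightarrow> real \<Rightarrow> complex) \<Rightarrow> complex \<Rightarrow> complex set set" where
  "odd_edges E \<gamma> z = {e \<in> E. \<exists>k::int. odd k \<and> winding_number (\<gamma> e) z =
     arg_about z (pathfinish (\<gamma> e)) - arg_about z (pathstart (\<gamma> e)) + of_int k}"

lemma winding_number_arg_about:
  assumes "path g" "z \<notin> path_image g"
  obtains k :: int where
    "winding_number g z = arg_about z (pathfinish g) - arg_about z (pathstart g) + of_int k"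
proof -
  let ?a = "pathstart g - z" and ?b = "pathfinish g - z"
  have nz: "?a \<noteq> 0" "?b \<noteq> 0" using assms(2) by auto
  have "exp (Ln ?b) = exp (2 * pi * \<i> * winding_number g z + Ln ?a)"
    using winding_number_exp_2pi[OF assms] nz by (simp add: exp_add)
  then obtain n :: int where "Ln ?b = 2 * pi * \<i> * winding_number g z + Ln ?a + (of_int (2 * n) * pi) * \<i>"
    unfolding exp_eq by blast
  then have "2 * pi * \<i> * winding_number g z = Ln ?b - Ln ?a + 2 * pi * \<i> * of_int (- n)"
    by (simp add: algebra_simps)
  then have "winding_number g z = (Ln ?b - Ln ?a + 2 * pi * \<i> * of_int (- n)) / (2 * pi * \<i>)"
    by (simp add: field_simps)
  also have "\<dots> = arg_about z (pathfinish g) - arg_about z (pathstart g) + of_int (- n)"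
    by (simp add: arg_about_def add_divide_distrib diff_divide_distrib)
  finally show thesis by (rule that)
qed

lemma oriented_edge:
  assumes G: "plane_graph V E \<gamma>" and e: "{u, v} \<in> E"
  obtains g where "arc g" "pathstart g = u" "pathfinish g = v"
    "path_image g = path_image (\<gamma> {u, v})"
    "\<And>z. z \<notin> drawing \<gamma> E \<Longrightarrow> \<exists>k::int. winding_number g z = arg_about z v - arg_about z u + of_int k \<and>
      (odd k \<longleftrightarrow> {u, v} \<in> odd_edges E \<gamma> z)"
proof -
  let ?e = "{u, v}" and ?s = "pathstart (\<gamma> {u, v})" and ?t = "pathfinish (\<gamma> {u, v})"
  have a: "arc (\<gamma> ?e)" using plane_graph_arc[OF G e] .
  have k: "\<exists>k::int. winding_number (\<gamma> ?e) z = arg_about z ?t - arg_about z ?s + of_int k \<and>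
      (odd k \<longleftrightarrow> {u, v} \<in> odd_edges E \<gamma> z)" if "z \<notin> drawing \<gamma> E" for z
  proof -
    have "z \<notin> path_image (\<gamma> ?e)" using that e by (auto simp: drawing_def)
    then obtain k :: int where k: "winding_number (\<gamma> ?e) z = arg_about z ?t - arg_about z ?s + of_int k"
      using winding_number_arg_about arc_imp_path[OF a] by blast
    then have "odd k \<longleftrightarrow> {u, v} \<in> odd_edges E \<gamma> z" using e by (auto simp: odd_edges_def)
    with k show ?thesis by blast
  qed
  have "{?s, ?t} = {u, v}" using plane_graph_ends[OF G e] .
  then consider "?s = u" "?t = v" | "?s = v" "?t = u" by (auto simp: doubleton_eq_iff)
  then show thesis
  proof cases
    case 1
    then show thesis using that[of "\<gamma> ?e"] a k by auto
  next
    case 2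
    show thesis
    proof (rule that[of "reversepath (\<gamma> ?e)"])
      fix z assume z: "z \<notin> drawing \<gamma> E"
      then have zi: "z \<notin> path_image (\<gamma> ?e)" using e by (auto simp: drawing_def)
      obtain k :: int where k: "winding_number (\<gamma> ?e) z = arg_about z ?t - arg_about z ?s + of_int k"
        "odd k \<longleftrightarrow> {u, v} \<in> odd_edges E \<gamma> z" using k[OF z] by blast
      then have "winding_number (reversepath (\<gamma> ?e)) z = arg_about z v - arg_about z u + of_int (- k)"
        using winding_number_reversepath[OF arc_imp_path[OF a] zi] 2 by simp
      moreover have "odd (- k) \<longleftrightarrow> {u, v} \<in> odd_edges E \<gamma> z" using k(2) by simp
      ultimately show "\<exists>k::int. winding_number (reversepath (\<gamma> ?e)) z = arg_about z v - arg_about z u + of_int k \<and>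
        (odd k \<longleftrightarrow> {u, v} \<in> odd_edges E \<gamma> z)" by blast
    qed (use 2 a in \<open>auto simp: arc_reversepath\<close>)
  qed
qed

lemma path_curve:
  assumes G: "plane_graph V E \<gamma>"
  shows "distinct vs \<Longrightarrow> length vs \<ge> 2 \<Longrightarrow> path_edges vs \<subseteq> E \<Longrightarrow>
    \<exists>g. arc g \<and> pathstart g = hd vs \<and> pathfinish g = last vs \<and>
      path_image g = drawing \<gamma> (path_edges vs) \<and>
      (\<forall>z. z \<notin> drawing \<gamma> E \<longrightarrow> (\<exists>k::int. winding_number g z = arg_about z (last vs) - arg_about z (hd vs) + of_int k \<and>
        (odd k \<longleftrightarrow> odd (card (path_edges vs \<inter> odd_edges E \<gamma> z)))))"
proof (induction vs rule: path_edges.induct)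
  case (3 x y xs)
  obtain g where g: "arc g" "pathstart g = x" "pathfinish g = y"
    "path_image g = path_image (\<gamma> {x, y})"
    "\<And>z. z \<notin> drawing \<gamma> E \<Longrightarrow> \<exists>k::int. winding_number g z = arg_about z y - arg_about z x + of_int k \<and>
      (odd k \<longleftrightarrow> {x, y} \<in> odd_edges E \<gamma> z)"
    using oriented_edge[OF G, of x y] "3.prems"(3) by (metis insert_subset path_edges.simps(3))
  show ?case
  proof (cases "xs = []")
    case True
    have "odd (card ({{x, y}} \<inter> odd_edges E \<gamma> z)) \<longleftrightarrow> {x, y} \<in> odd_edges E \<gamma> z" for z
      by (cases "{x, y} \<in> odd_edges E \<gamma> z") auto
    then show ?thesis using g True by (intro exI[of _ g]) (simp add: drawing_def)
  next
    case False
    let ?ys = "y # xs"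
    have "length ?ys \<ge> 2" using False by (cases xs) auto
    then obtain h where h: "arc h" "pathstart h = y" "pathfinish h = last ?ys"
      "path_image h = drawing \<gamma> (path_edges ?ys)"
      "\<And>z. z \<notin> drawing \<gamma> E \<Longrightarrow> \<exists>k::int. winding_number h z = arg_about z (last ?ys) - arg_about z y + of_int k \<and>
        (odd k \<longleftrightarrow> odd (card (path_edges ?ys \<inter> odd_edges E \<gamma> z)))"
      using 3 by auto
    have notin: "x \<notin> e" if "e \<in> path_edges ?ys" for e
      using Union_path_edges_subset[of ?ys] that "3.prems"(1) by auto
    then have nin: "{x, y} \<notin> path_edges ?ys" by blast
    have "path_image g \<inter> path_image h \<subseteq> {pathstart h}"
    proof
      fix p assume "p \<in> path_image g \<inter> path_image h"
      then obtain e where e: "e \<in> path_edges ?ys" "p \<in> path_image (\<gamma> e)" "p \<in> path_image (\<gamma> {x, y})"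
        using g(4) h(4) by (auto simp: drawing_def)
      have "p \<in> {x, y} \<inter> e"
        using plane_graph_Int[OF G, of "{x, y}" e] e "3.prems"(3) nin by auto
      then show "p \<in> {pathstart h}" using notin[OF e(1)] h(2) by auto
    qed
    then have arc: "arc (g +++ h)" using g h by (intro arc_join) auto
    have img: "path_image (g +++ h) = drawing \<gamma> (path_edges (x # ?ys))"
      using g h by (simp add: path_image_join drawing_insert)
    have "\<exists>k::int. winding_number (g +++ h) z = arg_about z (last ?ys) - arg_about z x + of_int k \<and>
        (odd k \<longleftrightarrow> odd (card (path_edges (x # ?ys) \<inter> odd_edges E \<gamma> z)))" if z: "z \<notin> drawing \<gamma> E" for z
    proof -
      obtain k :: int where k: "winding_number g z = arg_about z y - arg_about z x + of_int k"
        "odd k \<longleftrightarrow> {x, y} \<in> odd_edges E \<gamma> z" using g(5)[OF z] by blast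
      obtain l :: int where l: "winding_number h z = arg_about z (last ?ys) - arg_about z y + of_int l"
        "odd l \<longleftrightarrow> odd (card (path_edges ?ys \<inter> odd_edges E \<gamma> z))" using h(5)[OF z] by blast
      have zn: "z \<notin> path_image (g +++ h)"
        using z img drawing_mono[OF "3.prems"(3)] by blast
      have "winding_number (g +++ h) z = winding_number g z + winding_number h z"
        using g h zn by (intro winding_number_join) (auto simp: arc_imp_path path_image_join)
      then have "winding_number (g +++ h) z = arg_about z (last ?ys) - arg_about z x + of_int (k + l)"
        using k l by simp
      moreover have "odd (k + l) \<longleftrightarrow> odd (card (path_edges (x # ?ys) \<inter> odd_edges E \<gamma> z))"
        using k(2) l(2) nin by (cases "{x, y} \<in> odd_edges E \<gamma> z") (simp_all add: Int_insert_left)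
      ultimately show ?thesis by blast
    qed
    then show ?thesis using arc img g h by (intro exI[of _ "g +++ h"]) simp
  qed
qed auto

text \<open>Along a cycle the differences of \<open>arg_about\<close> telescope, so the parity of its winding number
  about z is additive over the edges.\<close>

lemma cycle_curve:
  assumes G: "plane_graph V E \<gamma>" and C: "C \<subseteq> E" "is_cycle C"
  obtains p where "simple_path p" "pathfinish p = pathstart p" "path_image p = drawing \<gamma> C"
    "\<And>z. z \<notin> drawing \<gamma> E \<Longrightarrow> z \<in> inside (drawing \<gamma> C) \<longleftrightarrow> odd (card (C \<inter> odd_edges E \<gamma> z))"
proof -
  have S: "simple_edges C" using simple_edges_subset[OF sgraph_simple_edges[OF plane_graph_sgraph[OF G]] C(1)] .
  obtain vs where vs: "distinct vs" "length vs \<ge> 3" "C = cyc_edges vs" using is_cycle_list[OF S C(2)] .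
  let ?x = "hd vs" and ?y = "last vs"
  have pE: "path_edges vs \<subseteq> E" and cE: "{?y, ?x} \<in> E" using C(1) vs(3) by (auto simp: cyc_edges_def)
  obtain g where g: "arc g" "pathstart g = ?x" "pathfinish g = ?y"
      "path_image g = drawing \<gamma> (path_edges vs)"
      "\<And>z. z \<notin> drawing \<gamma> E \<Longrightarrow> \<exists>k::int. winding_number g z = arg_about z ?y - arg_about z ?x + of_int k \<and>
        (odd k \<longleftrightarrow> odd (card (path_edges vs \<inter> odd_edges E \<gamma> z)))"
    using path_curve[OF G vs(1) _ pE] vs(2) by fastforce
  obtain h where h: "arc h" "pathstart h = ?y" "pathfinish h = ?x"
    "path_image h = path_image (\<gamma> {?y, ?x})"
    "\<And>z. z \<notin> drawing \<gamma> E \<Longrightarrow> \<exists>k::int. winding_number h z = arg_about z ?x - arg_about z ?y + of_int k \<and>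
      (odd k \<longleftrightarrow> {?y, ?x} \<in> odd_edges E \<gamma> z)"
    using oriented_edge[OF G cE] by metis
  \<comment> \<open>With at least 3 vertices the closing edge is new, so that the counts of odd
    edges on the path and on the closing edge add up.\<close>
  have nin: "{?y, ?x} \<notin> path_edges vs"
  proof -
    obtain a b c zs where v: "vs = a # b # c # zs" using vs(2)
      by (cases vs rule: path_edges.cases) (auto simp: Suc_le_length_iff numeral_3_eq_3)
    have "?y \<noteq> a" "?y \<noteq> b" using vs(1) v last_in_set[of "c # zs"] by auto
    moreover have "a \<notin> \<Union>(path_edges (b # c # zs))"
      using Union_path_edges_subset[of "b # c # zs"] vs(1) v by auto
    ultimately show ?thesis unfolding v by (auto simp: doubleton_eq_iff)
  qed
  have arcs: "path_image g \<inter> path_image h \<subseteq> {pathstart g, pathstart h}"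
  proof
    fix p assume "p \<in> path_image g \<inter> path_image h"
    then obtain e where e: "e \<in> path_edges vs" "p \<in> path_image (\<gamma> e)" "p \<in> path_image (\<gamma> {?y, ?x})"
      using g(4) h(4) by (auto simp: drawing_def)
    then have "p \<in> {?y, ?x} \<inter> e"
      using plane_graph_Int[OF G cE, of e] pE nin by auto
    then show "p \<in> {pathstart g, pathstart h}" using g(2) h(2) by auto
  qed
  have sp: "simple_path (g +++ h)" using g h arcs by (intro simple_path_join_loop) auto
  have loop: "pathfinish (g +++ h) = pathstart (g +++ h)" using g h by simp
  have img: "path_image (g +++ h) = drawing \<gamma> C"
    using g h by (auto simp: path_image_join vs(3) cyc_edges_def drawing_insert)
  have "z \<in> inside (drawing \<gamma> C) \<longleftrightarrow> odd (card (C \<inter> odd_edges E \<gamma> z))" if z: "z \<notin> drawing \<gamma> E" for z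
  proof -
    obtain k :: int where k: "winding_number g z = arg_about z ?y - arg_about z ?x + of_int k"
      "odd k \<longleftrightarrow> odd (card (path_edges vs \<inter> odd_edges E \<gamma> z))" using g(5)[OF z] by blast
    obtain l :: int where l: "winding_number h z = arg_about z ?x - arg_about z ?y + of_int l"
      "odd l \<longleftrightarrow> {?y, ?x} \<in> odd_edges E \<gamma> z" using h(5)[OF z] by blast
    have zn: "z \<notin> path_image (g +++ h)" using z img drawing_mono[OF C(1)] by blast
    have "winding_number (g +++ h) z = winding_number g z + winding_number h z"
      using g h zn by (intro winding_number_join) (auto simp: arc_imp_path path_image_join)
    then have w: "winding_number (g +++ h) z = of_int (k + l)" using k l by simp
    have par: "odd (k + l) \<longleftrightarrow> odd (card (C \<inter> odd_edges E \<gamma> z))"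
      using k(2) l(2) nin
      by (cases "{?y, ?x} \<in> odd_edges E \<gamma> z") (simp_all add: vs(3) cyc_edges_def Int_insert_left)
    \<comment> \<open>The winding number k + l is 1 or -1 inside the curve and 0 outside, so its
      parity tells the two apart.\<close>
    show ?thesis
    proof (cases "z \<in> inside (drawing \<gamma> C)")
      case True
      then have "winding_number (g +++ h) z = 1 \<or> winding_number (g +++ h) z = - 1"
        using simple_closed_path_winding_number_inside[OF sp] img by metis
      then have "k + l = 1 \<or> k + l = - 1" unfolding w
        by (simp only: of_int_eq_1_iff of_int_eq_iff[of _ "- 1", simplified])
      then have "odd (k + l)" by (elim disjE) simp_all
      then show ?thesis using True par by simp
    next
      case False
      then have "z \<in> outside (path_image (g +++ h))"
        using zn inside_Un_outside[of "path_image (g +++ h)"] unfolding img by blast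
      then have "winding_number (g +++ h) z = 0"
        by (rule winding_number_zero_in_outside[OF simple_path_imp_path[OF sp] loop])
      then have "k + l = 0" unfolding w by (simp only: of_int_eq_0_iff)
      then have "even (k + l)" by simp
      then show ?thesis using False par by simp
    qed
  qed
  with sp loop img that show thesis by blast
qed

lemma cycle_Jordan:
  assumes "plane_graph V E \<gamma>" "C \<subseteq> E" "is_cycle C"
  shows "inside (drawing \<gamma> C) \<noteq> {}" "open (inside (drawing \<gamma> C))" "connected (inside (drawing \<gamma> C))"
    "bounded (inside (drawing \<gamma> C))" "open (outside (drawing \<gamma> C))" "connected (outside (drawing \<gamma> C))"
    "\<not> bounded (outside (drawing \<gamma> C))" "frontier (inside (drawing \<gamma> C)) = drawing \<gamma> C"
    "frontier (outside (drawing \<gamma> C)) = drawing \<gamma> C"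
    "closure (inside (drawing \<gamma> C)) = drawing \<gamma> C \<union> inside (drawing \<gamma> C)"
proof -
  obtain p where p: "simple_path p" "pathfinish p = pathstart p" "path_image p = drawing \<gamma> C"
    using cycle_curve[OF assms] by metis
  note J = Jordan_inside_outside[OF p(1,2), unfolded p(3)]
  show "inside (drawing \<gamma> C) \<noteq> {}" "open (inside (drawing \<gamma> C))" "connected (inside (drawing \<gamma> C))"
    "bounded (inside (drawing \<gamma> C))" "open (outside (drawing \<gamma> C))" "connected (outside (drawing \<gamma> C))"
    "\<not> bounded (outside (drawing \<gamma> C))" and fr: "frontier (inside (drawing \<gamma> C)) = drawing \<gamma> C"
    and "frontier (outside (drawing \<gamma> C)) = drawing \<gamma> C"
    using J by auto
  show "closure (inside (drawing \<gamma> C)) = drawing \<gamma> C \<union> inside (drawing \<gamma> C)"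
    using fr closure_Un_frontier by blast
qed

text \<open>The open arc. In a plane graph it meets no vertex and no other edge, so one of its
  points identifies the edge; and it is dense in the closed arc.\<close>

definition edge_interior :: "(complex set \<Rightarrow> real \<Rightarrow> complex) \<Rightarrow> complex set \<Rightarrow> complex set" where
  "edge_interior \<gamma> e = path_image (\<gamma> e) - e"

lemma edge_interior_props:
  assumes G: "plane_graph V E \<gamma>" and e: "e \<in> E"
  shows "connected (edge_interior \<gamma> e)" "edge_interior \<gamma> e \<noteq> {}"
    "path_image (\<gamma> e) \<subseteq> closure (edge_interior \<gamma> e)" "edge_interior \<gamma> e \<inter> V = {}"
proof -
  have a: "arc (\<gamma> e)" and ends: "{pathstart (\<gamma> e), pathfinish (\<gamma> e)} = e"
    using plane_graph_arc[OF G e] plane_graph_ends[OF G e] .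
  show c: "connected (edge_interior \<gamma> e)" unfolding edge_interior_def
    using connected_simple_path_endless[OF arc_imp_simple_path[OF a]] by (simp add: ends)
  show "edge_interior \<gamma> e \<noteq> {}" unfolding edge_interior_def
    using nonempty_simple_path_endless[OF arc_imp_simple_path[OF a]] by (simp add: ends)
  have fe: "finite e" using ends by (metis finite.emptyI finite_insert)
  show "path_image (\<gamma> e) \<subseteq> closure (edge_interior \<gamma> e)"
  proof
    fix x assume x: "x \<in> path_image (\<gamma> e)"
    have inf: "infinite (path_image (\<gamma> e))"
      using arc_image_uncountable[OF a] countable_finite by blast
    have "x islimpt path_image (\<gamma> e)"
      by (rule connected_imp_perfect[OF connected_arc_image[OF a] x]) (metis inf finite.emptyI finite_insert)
    then have "x islimpt (e \<union> edge_interior \<gamma> e)"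
      by (rule islimpt_subset) (auto simp: edge_interior_def)
    then have "x islimpt edge_interior \<gamma> e" using islimpt_Un_finite[OF fe] by blast
    then show "x \<in> closure (edge_interior \<gamma> e)" by (simp add: closure_def)
  qed
  show "edge_interior \<gamma> e \<inter> V = {}" using plane_graph_vertices[OF G e] by (auto simp: edge_interior_def)
qed

lemma edge_interior_drawing:
  assumes "plane_graph V E \<gamma>" "e \<in> E" "D \<subseteq> E" "p \<in> edge_interior \<gamma> e" "p \<in> drawing \<gamma> D"
  shows "e \<in> D"
proof -
  obtain e' where "e' \<in> D" "p \<in> path_image (\<gamma> e')" using assms(5) by (auto simp: drawing_def)
  then show ?thesis
    using plane_graph_Int[OF assms(1,2), of e'] assms(3,4) by (auto simp: edge_interior_def)
qed

lemma drawing_subset_imp_subset: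
  assumes "plane_graph V E \<gamma>" "C \<subseteq> E" "D \<subseteq> E" "drawing \<gamma> C \<subseteq> drawing \<gamma> D"
  shows "C \<subseteq> D"
proof
  fix e assume e: "e \<in> C"
  then obtain p where p: "p \<in> edge_interior \<gamma> e" using edge_interior_props(2)[OF assms(1)] assms(2) by blast
  then have "p \<in> drawing \<gamma> D" using assms(4) e by (auto simp: edge_interior_def drawing_def)
  then show "e \<in> D" using edge_interior_drawing[OF assms(1) _ assms(3) p] assms(2) e by blast
qed

lemma vertex_in_drawing_iff:
  assumes "plane_graph V E \<gamma>" "D \<subseteq> E" "v \<in> V"
  shows "v \<in> drawing \<gamma> D \<longleftrightarrow> v \<in> \<Union>D"
proof -
  have "v \<in> path_image (\<gamma> e) \<longleftrightarrow> v \<in> e" if "e \<in> D" for e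
    using plane_graph_vertices[OF assms(1), of e] that assms(2,3) by blast
  then show ?thesis by (auto simp: drawing_def)
qed

text \<open>An open piece of the plane inside an arc would embed in the line, against invariance of
  dimension; finite unions of closed sets preserve empty interior.\<close>

lemma interior_drawing_empty:
  assumes G: "plane_graph V E \<gamma>" and "D \<subseteq> E"
  shows "interior (drawing \<gamma> D) = {}"
proof -
  have arcs: "interior (path_image (\<gamma> e)) = {}" if e: "e \<in> E" for e
  proof (rule ccontr)
    assume ne: "interior (path_image (\<gamma> e)) \<noteq> {}"
    have "path_image (\<gamma> e) homeomorphic {0..1::real}"
      by (rule homeomorphic_arc_image_interval[OF plane_graph_arc[OF G e]]) simp
    then obtain f g where fg: "homeomorphism (path_image (\<gamma> e)) {0..1::real} f g"
      unfolding homeomorphic_def by blast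
    have "DIM(complex) \<le> DIM(real)"
    proof (rule invariance_of_dimension[OF _ open_interior _ ne])
      show "continuous_on (interior (path_image (\<gamma> e))) f"
        by (rule continuous_on_subset[OF homeomorphism_cont1[OF fg] interior_subset])
      show "inj_on f (interior (path_image (\<gamma> e)))"
        by (rule inj_on_subset[OF _ interior_subset]) (rule inj_on_inverseI[of _ g], rule homeomorphism_apply1[OF fg])
    qed
    then show False by simp
  qed
  have "finite D" using sgraph_simple_edges[OF plane_graph_sgraph[OF G]] assms(2) finite_subset by blast
  then show ?thesis using assms(2)
  proof (induction D rule: finite_induct)
    case (insert e D)
    then have "interior (path_image (\<gamma> e) \<union> drawing \<gamma> D) = interior (path_image (\<gamma> e))"
      by (intro interior_closed_Un_empty_interior closed_arc_image plane_graph_arc[OF G]) auto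
    then show ?case using arcs insert by (simp add: drawing_insert)
  qed (simp add: drawing_def)
qed

lemma closure_diff_drawing:
  assumes "plane_graph V E \<gamma>" "D \<subseteq> E" "open U" "finite W"
  shows "closure (U - drawing \<gamma> D - W) = closure U"
proof -
  have "interior (drawing \<gamma> D \<union> W) = {}"
    using interior_closed_Un_empty_interior[OF compact_imp_closed[OF compact_drawing[OF assms(1,2)]], of W]
      empty_interior_finite[OF assms(4)] interior_drawing_empty[OF assms(1,2)] by simp
  then have "closure (- (drawing \<gamma> D \<union> W)) = UNIV" unfolding closure_complement by simp
  then have "closure (U \<inter> - (drawing \<gamma> D \<union> W)) = closure U"
    using closure_open_Int_superset[OF assms(3)] by simp
  then show ?thesis by (simp add: Diff_eq Int_assoc)
qed

text \<open>By Janiszewski's theorem F is a component U of the complement of Y minus the arc k, and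
  U contains k except possibly its final point.\<close>

lemma closure_reaches_arc_start:
  fixes k :: "real \<Rightarrow> complex"
  assumes k: "arc k" and Y: "closed Y" and kY: "path_image k \<inter> Y \<subseteq> {pathfinish k}"
    and F: "connected F" "F \<inter> (path_image k \<union> Y) = {}" "frontier F \<subseteq> path_image k \<union> Y"
    and p: "p \<in> path_image k" "p \<in> frontier F" "p \<noteq> pathfinish k"
  shows "pathstart k \<in> closure F"
proof -
  let ?K = "path_image k"
  have pY: "p \<notin> Y" using kY p by blast
  have "F \<noteq> {}" using p(2) by auto
  then obtain x where x: "x \<in> F" by blast
  define U where "U = connected_component_set (- Y) x"
  have FY: "F \<subseteq> - Y" using F(2) by blast
  then have FU: "F \<subseteq> U" unfolding U_def using F(1) x by (simp add: connected_component_maximal)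
  have oU: "open U" unfolding U_def using Y by (simp add: open_connected_component open_Compl)
  have Uy: "U \<subseteq> - Y" unfolding U_def by (rule connected_component_subset)
  have UF: "U - ?K \<subseteq> F"
  proof
    \<comment> \<open>The arc and Y meet in at most one point, hence in a connected set. Neither
      separates x from y, so by Janiszewski their union does not.\<close>
    fix y assume y: "y \<in> U - ?K"
    have "connected_component (- (?K \<union> Y)) x y"
    proof (rule Janiszewski)
      show "compact ?K" by (rule compact_arc_image[OF k])
      show "closed Y" by (rule Y)
      show "connected (?K \<inter> Y)" using kY by (metis connected_empty connected_sing subset_singletonD)
      show "connected_component (- Y) x y" using y by (simp add: U_def)
      have "connected (- ?K)" by (rule connected_arc_complement[OF k]) simp
      moreover have "x \<in> - ?K" "y \<in> - ?K" using x F(2) y by auto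
      ultimately show "connected_component (- ?K) x y" by (metis connected_iff_connected_component)
    qed
    \<comment> \<open>The component of x cannot leave F, because the frontier of F lies in the union
      of the arc and Y.\<close>
    then have "y \<in> connected_component_set (- (?K \<union> Y)) x" (is "y \<in> ?W") by simp
    have "?W \<inter> F \<noteq> {}" using x F(2) connected_component_refl[of x "- (?K \<union> Y)"] by blast
    moreover have "?W \<inter> frontier F = {}" using F(3) connected_component_subset[of "- (?K \<union> Y)" x] by blast
    ultimately have "?W \<subseteq> F" using connected_Int_frontier[OF connected_connected_component[of "- (?K \<union> Y)" x], of F] by blast
    then show "y \<in> F" using \<open>y \<in> ?W\<close> by blast
  qed
  \<comment> \<open>A small ball around p misses Y and meets F.\<close>
  have pU: "p \<in> U"
  proof -
    obtain r where r: "r > 0" "ball p r \<subseteq> - Y" using pY Y by (metis ComplI open_Compl openE)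
    have "p \<in> closure F" using p(2) by (simp add: frontier_def)
    then obtain y where y: "y \<in> F" "dist y p < r" using r(1) by (meson closure_approachable)
    have "ball p r \<subseteq> connected_component_set (- Y) y"
      by (rule connected_component_maximal) (use y r in \<open>auto simp: dist_commute\<close>)
    moreover have "connected_component_set (- Y) y = U"
      using FU y(1) unfolding U_def by (metis connected_component_eq subsetD)
    ultimately show ?thesis using r(1) by (metis centre_in_ball subsetD)
  qed
  have "?K - Y \<subseteq> U"
  proof -
    have "connected (k ` {0..<1})"
      using k by (intro connected_continuous_image connected_Ico)
        (auto simp: arc_def path_def intro: continuous_on_subset)
    moreover have im: "k ` {0..<1} = ?K - {pathfinish k}"
    proof -
      have "k t \<noteq> k 1" if "0 \<le> t" "t < 1" for t
        using k that inj_onD[of k "{0..1}" t 1] by (auto simp: arc_def)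
      moreover have "{0..1} = insert 1 {0..<1::real}" by auto
      ultimately show ?thesis by (auto simp: path_image_def pathfinish_def)
    qed
    ultimately have "?K - {pathfinish k} \<subseteq> connected_component_set (- Y) p"
      using kY p pY by (intro connected_component_maximal) auto
    moreover have "connected_component_set (- Y) p = U"
      using pU unfolding U_def by (metis connected_component_eq)
    ultimately have KU: "?K - {pathfinish k} \<subseteq> U" by simp
    show ?thesis
    proof (cases "pathfinish k \<in> Y")
      case False
      have "connected ?K" by (rule connected_arc_image[OF k])
      then have "?K \<subseteq> connected_component_set (- Y) p"
        using False kY p(1) by (intro connected_component_maximal) auto
      then show ?thesis using \<open>connected_component_set (- Y) p = U\<close> by blast
    qed (use KU in blast)
  qed
  moreover have "pathstart k \<in> ?K - Y"
    using kY arc_distinct_ends[OF k] by auto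
  ultimately have sU: "pathstart k \<in> U" by blast
  \<comment> \<open>An arc, viewed as a plane graph with one edge, has empty interior. So
    \<open>U - ?K\<close>, a part of F, is dense in U, which contains the start of k.\<close>
  have "interior ?K = {}"
  proof -
    have "plane_graph {pathstart k, pathfinish k} {{pathstart k, pathfinish k}} (\<lambda>_. k)"
      using k arc_distinct_ends[OF k] by (auto simp: plane_graph_def)
    from interior_drawing_empty[OF this order_refl] show ?thesis by (simp add: drawing_def)
  qed
  then have "closure (U \<inter> - ?K) = closure U"
    using closure_open_Int_superset[OF oU, of "- ?K"] by (simp add: closure_complement)
  moreover have "closure (U \<inter> - ?K) \<subseteq> closure F" by (rule closure_mono) (use UF in blast)
  ultimately show ?thesis using sU closure_subset by blast
qed

section \<open>Faces and interiors of cycles\<close>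

text \<open>If a point q of the edge is off the closure of F, so is a gap next to q. The piece of
  the edge from the gap through p to an end of the edge can touch the rest only at that end. By
  \<open>closure_reaches_arc_start\<close> its loose end, which lies near q, would be in the closure
  of F.\<close>

lemma frontier_face_edge:
  assumes G: "plane_graph V E \<gamma>" and F: "F \<in> components (- drawing \<gamma> E)"
    and e: "e \<in> E" and p: "p \<in> edge_interior \<gamma> e" "p \<in> frontier F"
  shows "path_image (\<gamma> e) \<subseteq> frontier F"
proof (rule ccontr)
  assume not: "\<not> path_image (\<gamma> e) \<subseteq> frontier F"
  define g where "g = \<gamma> e"
  define R where "R = drawing \<gamma> (E - {e})"
  have a: "arc g" and ends: "e = {g 0, g 1}"
    using plane_graph_arc[OF G e] plane_graph_ends[OF G e] by (auto simp: g_def pathstart_def pathfinish_def)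
  have inj: "g r = g r' \<Longrightarrow> r \<in> {0..1} \<Longrightarrow> r' \<in> {0..1} \<Longrightarrow> r = r'" for r r'
    using a by (auto simp: arc_def dest: inj_onD)
  have cont: "continuous_on {0..1} g" using a by (simp add: arc_def path_def)
  have img: "path_image (\<gamma> e) = g ` {0..1}" by (simp add: g_def path_image_def)
  have RE: "drawing \<gamma> E = R \<union> g ` {0..1}" using e img unfolding R_def drawing_def by auto
  have cR: "closed R" unfolding R_def by (rule compact_imp_closed[OF compact_drawing[OF G Diff_subset]])
  have frF: "frontier F \<subseteq> drawing \<gamma> E"
    using frontier_of_components_closed_complement[OF compact_imp_closed[OF compact_drawing[OF G order_refl]] F] .
  have FE: "F \<inter> drawing \<gamma> E = {}" using in_components_subset[OF F] by blast
  have "\<not> edge_interior \<gamma> e \<subseteq> frontier F"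
    using not edge_interior_props(3)[OF G e] closure_minimal[OF _ frontier_closed[of F]] by blast
  then obtain q where q: "q \<in> edge_interior \<gamma> e" "q \<notin> frontier F" by blast
  have param: "\<exists>r. 0 < r \<and> r < 1 \<and> x = g r" if "x \<in> edge_interior \<gamma> e" for x
  proof -
    have "x \<in> g ` {0..1}" using that img by (simp add: edge_interior_def)
    then obtain r where "r \<in> {0..1}" "x = g r" by blast
    moreover have "r \<noteq> 0" "r \<noteq> 1" using calculation that ends by (auto simp: edge_interior_def)
    ultimately show ?thesis by (intro exI[of _ r]) auto
  qed
  obtain s where s: "0 < s" "s < 1" "q = g s" using param[OF q(1)] by blast
  obtain t where t: "0 < t" "t < 1" "p = g t" using param[OF p(1)] by blast
  have "s \<noteq> t" using q p(2) s t by auto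
  have "q \<notin> F" using q(1) FE RE img by (auto simp: edge_interior_def)
  then have "q \<notin> closure F" using q(2) by (simp add: closure_Un_frontier)
  then have "g s \<in> - closure F" using s by simp
  then have "\<exists>d>0. \<forall>r\<in>{0..1}. dist r s < d \<longrightarrow> g r \<in> - closure F"
  proof -
    obtain \<epsilon> where eps: "\<epsilon> > 0" "ball (g s) \<epsilon> \<subseteq> - closure F"
      using \<open>g s \<in> - closure F\<close> open_Compl[OF closed_closure[of F]] openE by blast
    have "s \<in> {0..1}" using s by simp
    then obtain d where "d > 0" "\<forall>r\<in>{0..1}. dist r s < d \<longrightarrow> dist (g r) (g s) < \<epsilon>"
      using cont eps(1) unfolding continuous_on_iff by blast
    then show ?thesis using eps(2) by (metis dist_commute mem_ball subsetD)
  qed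
  then obtain d where d: "d > 0" "\<And>r. r \<in> {0..1} \<Longrightarrow> dist r s < d \<Longrightarrow> g r \<notin> closure F" by blast
  \<comment> \<open>I and J parametrise the pieces of the edge on the two sides of the gap, and I
    contains the parameter t of p; c is the end of the edge in I (0 or 1) and u the loose
    end.\<close>
  have stub: False
    if uc: "u \<in> {0..1}" "c \<in> {0..1}" "u \<noteq> c" and I: "path_image (subpath u c g) = g ` I" "I \<subseteq> {0..1}"
      and J: "compact J" "J \<subseteq> {0..1}" "I \<inter> J = {}" and c: "\<And>x. x \<in> {0, 1} \<Longrightarrow> x \<in> I \<Longrightarrow> x = c"
      and tI: "t \<in> I" "t \<noteq> c" and u: "dist u s < d"
      and gap: "\<And>r. r \<in> {0..1} \<Longrightarrow> r \<notin> I \<Longrightarrow> r \<notin> J \<Longrightarrow> dist r s < d" for u c :: real and I J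
  proof -
    let ?k = "subpath u c g" and ?Y = "R \<union> g ` J"
    have k: "arc ?k" using arc_subpath_arc[OF a uc] .
    have fin: "pathfinish ?k = g c" by simp
    have RI: "x = g c" if x: "x \<in> R" "x \<in> g ` I" for x
    proof -
      obtain e' where e': "e' \<in> E" "e' \<noteq> e" "x \<in> path_image (\<gamma> e')" using x(1) by (auto simp: R_def drawing_def)
      have "x \<in> path_image (\<gamma> e)" using x(2) I(2) img by blast
      then have "x \<in> e" using plane_graph_Int[OF G e e'(1)] e' by blast
      then obtain b where b: "b \<in> {0, 1}" "x = g b" using ends by blast
      obtain r where r: "r \<in> I" "x = g r" using x(2) by blast
      have "b = r" by (rule inj) (use b r I(2) in auto)
      then show ?thesis using c[of b] b r by simp
    qed
    have IJ: "g ` I \<inter> g ` J = {}" using I(2) J(2,3) inj by blast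
    have "pathstart ?k \<in> closure F"
    proof (rule closure_reaches_arc_start[OF k])
      show "closed ?Y"
        using compact_continuous_image[OF continuous_on_subset[OF cont J(2)] J(1)]
        by (intro closed_Un cR compact_imp_closed)
      show "path_image ?k \<inter> ?Y \<subseteq> {pathfinish ?k}" using RI IJ unfolding I(1) fin by blast
      show "connected F" by (rule in_components_connected[OF F])
      have "path_image ?k \<union> ?Y \<subseteq> drawing \<gamma> E"
        unfolding I(1) RE using image_mono[OF I(2), of g] image_mono[OF J(2), of g] by auto
      then show "F \<inter> (path_image ?k \<union> ?Y) = {}" using FE by auto
      show "frontier F \<subseteq> path_image ?k \<union> ?Y"
      proof
        fix x assume x: "x \<in> frontier F"
        show "x \<in> path_image ?k \<union> ?Y"
        proof (cases "x \<in> R")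
          case False
          then obtain r where r: "r \<in> {0..1}" "x = g r" using x frF RE by blast
          have "x \<in> closure F" using x by (simp add: frontier_def)
          then have "r \<in> I \<or> r \<in> J" using gap[OF r(1)] d(2)[OF r(1)] r(2) by blast
          then show ?thesis using r(2) unfolding I(1) by blast
        qed simp
      qed
      show "p \<in> path_image ?k" using tI t(3) unfolding I(1) by blast
      show "p \<in> frontier F" by (rule p(2))
      show "p \<noteq> pathfinish ?k" using inj[of t c] tI(2) t uc(2) by auto
    qed
    then show False using d(2)[OF uc(1) u] by simp
  qed
  show False
  proof (cases "s < t")
    case True
    \<comment> \<open>Strictly between s and t and closer than d to s; the gap consists of the
      parameters between s and u.\<close>
    define u where "u = min (s + d / 2) ((s + t) / 2)"
    have u: "s < u" "u < t" "u - s < d" using True d(1) by (auto simp: u_def min_def)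
    show False
    proof (rule stub[of u 1 "{u..1}" "{0..s}"])
      show "path_image (subpath u 1 g) = g ` {u..1}" using u s t by (simp add: path_image_subpath)
    qed (use u s t in \<open>auto simp: dist_real_def\<close>)
  next
    case False
    then have "t < s" using \<open>s \<noteq> t\<close> by simp
    define u where "u = max (s - d / 2) ((s + t) / 2)"
    have u: "t < u" "u < s" "s - u < d" using \<open>t < s\<close> d(1) by (auto simp: u_def max_def field_simps)
    show False
    proof (rule stub[of u 0 "{0..u}" "{s..1}"])
      show "path_image (subpath u 0 g) = g ` {0..u}" using u s t by (simp add: path_image_subpath)
    qed (use u s t in \<open>auto simp: dist_real_def\<close>)
  qed
qed

lemma connected_inside_or_outside:
  assumes "plane_graph V E \<gamma>" "C \<subseteq> E" "is_cycle C" "connected S" "S \<inter> drawing \<gamma> C = {}"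
  shows "S \<subseteq> inside (drawing \<gamma> C) \<or> S \<subseteq> outside (drawing \<gamma> C)"
proof -
  have "S \<subseteq> inside (drawing \<gamma> C) \<or> S \<inter> inside (drawing \<gamma> C) = {}"
    using connected_Int_frontier[OF assms(4), of "inside (drawing \<gamma> C)"]
      cycle_Jordan(8)[OF assms(1-3)] assms(5) by blast
  then show ?thesis using assms(5) inside_Un_outside[of "drawing \<gamma> C"] by blast
qed

lemma face_boundary_subset: "face_boundary E \<gamma> F \<subseteq> E"
  by (auto simp: face_boundary_def)

text \<open>The frontier of F lies in the boundary cycle and the finite set V. Deleting finitely
  many points does not disconnect a connected open set of the plane, so F fills one side of the
  cycle up to vertices; being bounded, it fills the inside.\<close>

lemma interior_face_cycle:
  assumes G: "plane_graph V E \<gamma>" and F: "interior_face E \<gamma> F" and B: "is_cycle (face_boundary E \<gamma> F)"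
  shows "F \<subseteq> inside (drawing \<gamma> (face_boundary E \<gamma> F))"
    and "inside (drawing \<gamma> (face_boundary E \<gamma> F)) - V \<subseteq> F"
proof -
  let ?B = "face_boundary E \<gamma> F"
  note J = cycle_Jordan[OF G face_boundary_subset B]
  have FC: "F \<in> components (- drawing \<gamma> E)" and bd: "bounded F" using F by (auto simp: interior_face_def)
  have cE: "closed (drawing \<gamma> E)" by (rule compact_imp_closed[OF compact_drawing[OF G order_refl]])
  have con: "connected F" and FE: "F \<inter> drawing \<gamma> E = {}" and Fne: "F \<noteq> {}"
    using in_components_connected[OF FC] in_components_subset[OF FC] in_components_nonempty[OF FC] by blast+
  have opF: "open F" using open_components[OF open_Compl[OF cE] FC] .
  have finV: "finite V" using plane_graph_sgraph[OF G] by (simp add: sgraph_def)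
  have frF: "frontier F \<subseteq> drawing \<gamma> ?B \<union> V"
  proof
    fix x assume x: "x \<in> frontier F"
    then obtain e where e: "e \<in> E" "x \<in> path_image (\<gamma> e)"
      using frontier_of_components_closed_complement[OF cE FC] by (auto simp: drawing_def)
    show "x \<in> drawing \<gamma> ?B \<union> V"
    proof (cases "x \<in> e")
      case True
      then show ?thesis using plane_graph_vertices[OF G e(1)] by blast
    next
      case False
      then have "path_image (\<gamma> e) \<subseteq> frontier F"
        using frontier_face_edge[OF G FC e(1) _ x] e by (auto simp: edge_interior_def)
      then have "e \<in> ?B" using e by (simp add: face_boundary_def)
      then show ?thesis using e by (auto simp: drawing_def)
    qed
  qed
  have whole: "W - V \<subseteq> F" if W: "open W" "connected W" "W \<inter> drawing \<gamma> ?B = {}" "F \<subseteq> W" for W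
  proof -
    have "connected (W - V)" by (rule connected_open_delete_finite[OF W(1,2) _ finV]) simp
    moreover have "infinite F" using opF Fne finite_imp_not_open by blast
    then have "F - V \<noteq> {}" using finV by (metis Diff_eq_empty_iff finite_subset)
    then have "(W - V) \<inter> F \<noteq> {}" using W(4) by blast
    moreover have "(W - V) \<inter> frontier F = {}" using frF W(3) by blast
    ultimately show ?thesis using connected_Int_frontier by blast
  qed
  have disj: "F \<inter> drawing \<gamma> ?B = {}" using FE drawing_mono[OF face_boundary_subset] by blast
  have "\<not> F \<subseteq> outside (drawing \<gamma> ?B)"
  proof
    assume "F \<subseteq> outside (drawing \<gamma> ?B)"
    then have "outside (drawing \<gamma> ?B) - V \<subseteq> F" by (intro whole J) auto
    then have "outside (drawing \<gamma> ?B) \<subseteq> F \<union> V" by blast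
    then show False using J(7) bd finV by (meson bounded_Un bounded_subset finite_imp_bounded)
  qed
  then show in1: "F \<subseteq> inside (drawing \<gamma> ?B)"
    using connected_inside_or_outside[OF G face_boundary_subset B con disj] by blast
  show "inside (drawing \<gamma> ?B) - V \<subseteq> F" by (rule whole) (use J in1 in auto)
qed

section \<open>The subgraph I[C]\<close>

lemma IC_edges_iff:
  assumes G: "plane_graph V E \<gamma>" and C: "C \<subseteq> E" "is_cycle C" and e: "e \<in> E"
  shows "e \<in> IC_edges E \<gamma> C \<longleftrightarrow> e \<in> C \<or> edge_interior \<gamma> e \<subseteq> inside (drawing \<gamma> C)"
proof
  assume "e \<in> IC_edges E \<gamma> C"
  then have "path_image (\<gamma> e) \<subseteq> drawing \<gamma> C \<union> inside (drawing \<gamma> C)" by (simp add: IC_edges_def)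
  then show "e \<in> C \<or> edge_interior \<gamma> e \<subseteq> inside (drawing \<gamma> C)"
    using edge_interior_drawing[OF G e C(1)] unfolding edge_interior_def by blast
next
  assume "e \<in> C \<or> edge_interior \<gamma> e \<subseteq> inside (drawing \<gamma> C)"
  moreover have "path_image (\<gamma> e) \<subseteq> drawing \<gamma> C \<union> inside (drawing \<gamma> C)"
    if "edge_interior \<gamma> e \<subseteq> inside (drawing \<gamma> C)"
    using edge_interior_props(3)[OF G e] closure_mono[OF that] cycle_Jordan(10)[OF G C] by blast
  ultimately show "e \<in> IC_edges E \<gamma> C"
    using e image_subset_drawing[of e C \<gamma>] by (auto simp: IC_edges_def)
qed

lemma edge_meets_inside:
  assumes G: "plane_graph V E \<gamma>" and C: "C \<subseteq> E" "is_cycle C" and e: "e \<in> E"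
    and x: "x \<in> path_image (\<gamma> e)" "x \<in> inside (drawing \<gamma> C)"
  shows "edge_interior \<gamma> e \<subseteq> inside (drawing \<gamma> C)"
proof -
  have "x \<in> closure (edge_interior \<gamma> e)" using edge_interior_props(3)[OF G e] x(1) by blast
  then have ne: "inside (drawing \<gamma> C) \<inter> edge_interior \<gamma> e \<noteq> {}"
    using open_Int_closure_eq_empty[OF cycle_Jordan(2)[OF G C]] x(2) by blast
  have "e \<notin> C"
    using x image_subset_drawing[of e C \<gamma>] inside_no_overlap[of "drawing \<gamma> C"] by blast
  then have "edge_interior \<gamma> e \<inter> drawing \<gamma> C = {}" using edge_interior_drawing[OF G e C(1)] by blast
  from connected_inside_or_outside[OF G C edge_interior_props(1)[OF G e] this]
  show ?thesis using ne inside_Int_outside[of "drawing \<gamma> C"] by blast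
qed

lemma IC_edges_subset: "IC_edges E \<gamma> C \<subseteq> E"
  by (auto simp: IC_edges_def)

lemma subset_IC_edges: "C \<subseteq> E \<Longrightarrow> C \<subseteq> IC_edges E \<gamma> C"
  using image_subset_drawing[of _ C \<gamma>] by (auto simp: IC_edges_def)

lemma IC_vertices_eq:
  assumes "plane_graph V E \<gamma>" "C \<subseteq> E"
  shows "IC_vertices V \<gamma> C = \<Union>C \<union> (V \<inter> inside (drawing \<gamma> C))"
proof -
  have "\<Union>C \<subseteq> V" using plane_graph_sgraph[OF assms(1)] assms(2) by (auto simp: sgraph_def)
  then show ?thesis using vertex_in_drawing_iff[OF assms] by (auto simp: IC_vertices_def)
qed

lemma IC_sgraph:
  assumes G: "plane_graph V E \<gamma>"
  shows "sgraph (IC_vertices V \<gamma> C) (IC_edges E \<gamma> C)"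
proof -
  have "e \<subseteq> IC_vertices V \<gamma> C" if e: "e \<in> IC_edges E \<gamma> C" for e
  proof -
    have "e \<in> E" "path_image (\<gamma> e) \<subseteq> drawing \<gamma> C \<union> inside (drawing \<gamma> C)" using e by (auto simp: IC_edges_def)
    then show ?thesis using plane_graph_vertices[OF G, of e] unfolding IC_vertices_def by blast
  qed
  then show ?thesis using plane_graph_sgraph[OF G] IC_edges_subset[of E \<gamma> C]
    unfolding sgraph_def by (auto simp: IC_vertices_def)
qed

lemma inside_vertex_edge:
  assumes G: "plane_graph V E \<gamma>" and C: "C \<subseteq> E" "is_cycle C" and e: "e \<in> E"
    and v: "v \<in> e" "v \<in> inside (drawing \<gamma> C)"
  shows "e \<in> IC_edges E \<gamma> C"
  using edge_meets_inside[OF G C e _ v(2)] edge_subset_image[OF G e] v(1) IC_edges_iff[OF G C e] by blast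

text \<open>The outside of C is connected, unbounded and misses D, so it lies in an unbounded
  component of the complement of D.\<close>

lemma outside_mono_IC:
  assumes G: "plane_graph V E \<gamma>" and C: "C \<subseteq> E" "is_cycle C" and D: "D \<subseteq> IC_edges E \<gamma> C"
  shows "outside (drawing \<gamma> C) \<subseteq> outside (drawing \<gamma> D)"
proof
  fix x assume x: "x \<in> outside (drawing \<gamma> C)"
  have "drawing \<gamma> D \<subseteq> drawing \<gamma> C \<union> inside (drawing \<gamma> C)"
    using D by (auto simp: IC_edges_def drawing_def)
  then have "outside (drawing \<gamma> C) \<subseteq> - drawing \<gamma> D" by (simp add: outside_inside) blast
  then have "outside (drawing \<gamma> C) \<subseteq> connected_component_set (- drawing \<gamma> D) x"
    by (intro connected_component_maximal x cycle_Jordan(6)[OF G C])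
  then have "\<not> bounded (connected_component_set (- drawing \<gamma> D) x)"
    using cycle_Jordan(7)[OF G C] by (metis bounded_subset)
  then show "x \<in> outside (drawing \<gamma> D)" by (simp add: outside)
qed

text \<open>The strict inclusion drives the inductions in \<open>flip_cycle\<close> and
  \<open>even_cycle\<close>. If I[D] contained C, the two outsides would coincide, hence also their
  frontiers, and a drawing determines its edges.\<close>

lemma IC_mono:
  assumes G: "plane_graph V E \<gamma>" and C: "C \<subseteq> E" "is_cycle C" and D: "D \<subseteq> IC_edges E \<gamma> C" "is_cycle D"
  shows "IC_edges E \<gamma> D \<subseteq> IC_edges E \<gamma> C" "inside (drawing \<gamma> D) \<subseteq> inside (drawing \<gamma> C)"
    "D \<noteq> C \<Longrightarrow> IC_edges E \<gamma> D \<subset> IC_edges E \<gamma> C"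
proof -
  have DE: "D \<subseteq> E" using D(1) IC_edges_subset by blast
  have out: "outside (drawing \<gamma> C) \<subseteq> outside (drawing \<gamma> D)" by (rule outside_mono_IC[OF G C D(1)])
  then have "drawing \<gamma> D \<union> inside (drawing \<gamma> D) \<subseteq> drawing \<gamma> C \<union> inside (drawing \<gamma> C)"
    by (auto simp: union_with_inside)
  then show sub: "IC_edges E \<gamma> D \<subseteq> IC_edges E \<gamma> C" by (auto simp: IC_edges_def)
  show "inside (drawing \<gamma> D) \<subseteq> inside (drawing \<gamma> C)"
  proof
    fix x assume x: "x \<in> inside (drawing \<gamma> D)"
    \<comment> \<open>The inside of D is open and disjoint from the outside of C, hence from the
      closure of the latter, which contains the curve of C.\<close>
    have "x \<notin> closure (outside (drawing \<gamma> C))"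
    proof
      assume "x \<in> closure (outside (drawing \<gamma> C))"
      then have "inside (drawing \<gamma> D) \<inter> outside (drawing \<gamma> C) \<noteq> {}"
        using open_Int_closure_eq_empty[OF cycle_Jordan(2)[OF G DE D(2)]] x by blast
      then show False using out inside_Int_outside by blast
    qed
    then have "x \<notin> outside (drawing \<gamma> C)" "x \<notin> drawing \<gamma> C"
      using cycle_Jordan(9)[OF G C] by (auto simp: closure_Un_frontier)
    then show "x \<in> inside (drawing \<gamma> C)" by (simp add: inside_outside)
  qed
  show "IC_edges E \<gamma> D \<subset> IC_edges E \<gamma> C" if "D \<noteq> C"
  proof (rule ccontr)
    assume "\<not> ?thesis"
    then have "C \<subseteq> IC_edges E \<gamma> D" using sub subset_IC_edges[OF C(1), of \<gamma>] by blast
    then have "outside (drawing \<gamma> D) \<subseteq> outside (drawing \<gamma> C)" by (rule outside_mono_IC[OF G DE D(2)])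
    then have "drawing \<gamma> C = drawing \<gamma> D"
      using out cycle_Jordan(9)[OF G C] cycle_Jordan(9)[OF G DE D(2)] by (metis subset_antisym)
    then have "C = D" using drawing_subset_imp_subset[OF G C(1) DE] drawing_subset_imp_subset[OF G DE C(1)] by auto
    then show False using that by simp
  qed
qed

text \<open>The inside is connected and misses the drawing; it is maximal with this property because
  its frontier belongs to the drawing. This is the base case of \<open>flip_cycle\<close>.\<close>

lemma empty_cycle_face:
  assumes G: "plane_graph V E \<gamma>" and C: "C \<subseteq> E" "is_cycle C" and eq: "IC_edges E \<gamma> C = C"
  shows "interior_face E \<gamma> (inside (drawing \<gamma> C))" "face_boundary E \<gamma> (inside (drawing \<gamma> C)) = C"
proof -
  let ?F = "inside (drawing \<gamma> C)"
  note J = cycle_Jordan[OF G C]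
  have disj: "?F \<inter> drawing \<gamma> E = {}"
  proof -
    have False if "x \<in> ?F" "e \<in> E" "x \<in> path_image (\<gamma> e)" for x e
    proof -
      have "e \<in> C"
        using edge_meets_inside[OF G C that(2,3,1)] IC_edges_iff[OF G C that(2)] eq by blast
      then show False
        using image_subset_drawing[of e C \<gamma>] that inside_no_overlap[of "drawing \<gamma> C"] by blast
    qed
    then show ?thesis by (auto simp: drawing_def)
  qed
  have "T = ?F" if "?F \<subseteq> T" "T \<subseteq> - drawing \<gamma> E" "connected T" for T
  proof -
    have "T \<inter> frontier ?F = {}" using that(2) drawing_mono[OF C(1)] J(8) by blast
    then show ?thesis using connected_Int_frontier[OF that(3), of ?F] that(1) J(1) by blast
  qed
  then have "?F \<in> components (- drawing \<gamma> E)"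
    unfolding in_components_maximal using J(1,3) disj by blast
  then show "interior_face E \<gamma> ?F" using J(4) by (simp add: interior_face_def)
  have "e \<in> C" if "e \<in> E" "path_image (\<gamma> e) \<subseteq> drawing \<gamma> C" for e
    using edge_interior_props(2)[OF G that(1)] edge_interior_drawing[OF G that(1) C(1)] that(2)
    unfolding edge_interior_def by blast
  then show "face_boundary E \<gamma> ?F = C"
    using C(1) image_subset_drawing[of _ C \<gamma>] by (auto simp: face_boundary_def J(8))
qed

section \<open>Resonance graphs\<close>

lemma plane_graph_subset: "plane_graph V E \<gamma> \<Longrightarrow> D \<subseteq> E \<Longrightarrow> plane_graph V D \<gamma>"
  unfolding plane_graph_def by (meson subsetD)

text \<open>A vertex of C is matched inside C by alternation, and at a vertex inside C every edge of
  the graph belongs to I[C].\<close>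

lemma matching_edge_IC:
  assumes G: "plane_graph V E \<gamma>" and C: "C \<subseteq> E" "is_cycle C"
    and M: "perfect_matching V E M" "alternating M C" and e: "e \<in> M" "v \<in> e" "v \<in> IC_vertices V \<gamma> C"
  shows "e \<in> IC_edges E \<gamma> C"
proof -
  have eE: "e \<in> E" using M(1) e(1) by (auto simp: perfect_matching_def)
  have vV: "v \<in> V" using e(3) by (simp add: IC_vertices_def)
  consider "v \<in> \<Union>C" | "v \<in> inside (drawing \<gamma> C)" using e(3) IC_vertices_eq[OF G C(1)] by blast
  then show ?thesis
  proof cases
    case 1
    then obtain f where f: "f \<in> C \<inter> M" "v \<in> f"
      using M(2) unfolding alternating_def by (meson perfect_matchingE)
    then have "e = f" using perfect_matching_unique[OF M(1) vV e(1,2)] by blast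
    then show ?thesis using f subset_IC_edges[OF C(1)] by blast
  next
    case 2
    then show ?thesis using inside_vertex_edge[OF G C eE e(2)] by blast
  qed
qed

lemma perfect_matching_restrict_IC:
  assumes G: "plane_graph V E \<gamma>" and C: "C \<subseteq> E" "is_cycle C"
    and M: "perfect_matching V E M" "alternating M C"
  shows "perfect_matching (IC_vertices V \<gamma> C) (IC_edges E \<gamma> C) (M \<inter> IC_edges E \<gamma> C)"
  unfolding perfect_matching_def
proof (intro conjI ballI)
  fix v assume v: "v \<in> IC_vertices V \<gamma> C"
  then have "v \<in> V" by (simp add: IC_vertices_def)
  then have "\<exists>!e. e \<in> M \<and> v \<in> e" by (rule perfect_matching_ex1[OF M(1)])
  moreover have "e \<in> M \<inter> IC_edges E \<gamma> C \<and> v \<in> e \<longleftrightarrow> e \<in> M \<and> v \<in> e" for e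
    using matching_edge_IC[OF G C M _ _ v] by blast
  ultimately show "\<exists>!e. e \<in> M \<inter> IC_edges E \<gamma> C \<and> v \<in> e" by simp
qed simp

lemma perfect_matching_extend_IC:
  assumes G: "plane_graph V E \<gamma>" and C: "C \<subseteq> E" "is_cycle C"
    and M: "perfect_matching V E M" "alternating M C"
    and N: "perfect_matching (IC_vertices V \<gamma> C) (IC_edges E \<gamma> C) N"
  shows "perfect_matching V E (N \<union> (M - IC_edges E \<gamma> C))"
  unfolding perfect_matching_def
proof (intro conjI ballI)
  have NI: "N \<subseteq> IC_edges E \<gamma> C" using N by (simp add: perfect_matching_def)
  then show "N \<union> (M - IC_edges E \<gamma> C) \<subseteq> E"
    using M(1) IC_edges_subset[of E \<gamma> C] by (auto simp: perfect_matching_def)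
  fix v assume v: "v \<in> V"
  show "\<exists>!e. e \<in> N \<union> (M - IC_edges E \<gamma> C) \<and> v \<in> e"
  proof (cases "v \<in> IC_vertices V \<gamma> C")
    case True
    then have "e \<in> N \<union> (M - IC_edges E \<gamma> C) \<and> v \<in> e \<longleftrightarrow> e \<in> N \<and> v \<in> e" for e
      using matching_edge_IC[OF G C M _ _ True] by blast
    then show ?thesis using perfect_matching_ex1[OF N True] by simp
  next
    case False
    have "v \<notin> e" if "e \<in> IC_edges E \<gamma> C" for e
      using that False IC_sgraph[OF G, of C] unfolding sgraph_def by blast
    then have "e \<in> N \<union> (M - IC_edges E \<gamma> C) \<and> v \<in> e \<longleftrightarrow> e \<in> M \<and> v \<in> e" for e using NI by blast
    then show ?thesis using perfect_matching_ex1[OF M(1) v] by simp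
  qed
qed

text \<open>Induction on the number of edges of I[C]: a perfect matching N of I[C] using an edge that
  leaves C is joined to both M and M \<open>\<oplus>\<close> C by flipping cycles different from C.\<close>

lemma flip_cycle:
  assumes G: "plane_graph V E \<gamma>"
    and el: "\<And>C. nice_cycle V E C \<Longrightarrow> bipartite (IC_vertices V \<gamma> C) (IC_edges E \<gamma> C) \<and>
        elementary (IC_vertices V \<gamma> C) (IC_edges E \<gamma> C)"
    and "perfect_matching V E M" "C \<subseteq> E" "is_cycle C" "alternating M C"
  shows "(resonance_adj V E \<gamma>)\<^sup>*\<^sup>* M (sym_diff M C)"
  using assms(3-6)
proof (induction "card (IC_edges E \<gamma> C)" arbitrary: C M rule: less_induct)
  case less
  note C = less.prems(2,3) and M = less.prems(1,4)
  let ?H = "IC_edges E \<gamma> C" and ?W = "IC_vertices V \<gamma> C" and ?R = "resonance_adj V E \<gamma>"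
  let ?M = "sym_diff M C"
  have sg: "sgraph V E" and EV: "\<Union>E \<subseteq> V" using plane_graph_sgraph[OF G] by (auto simp: sgraph_def)
  have M': "perfect_matching V E ?M" "alternating ?M C"
    using perfect_matching_sym_diff[OF M(1) C(1) M(2)] alternating_sym_diff_self[OF M(2)] .
  show ?case
  proof (cases "?H = C")
    case True
    have "sym_diff M ?M = C" by blast
    then have "?R M ?M"
      unfolding resonance_adj_def using M(1) M'(1) C(2) empty_cycle_face[OF G C True]
      by (intro conjI exI[of _ "inside (drawing \<gamma> C)"]) auto
    then show ?thesis by blast
  next
    case False
    have nice: "nice_cycle V E C" by (rule nice_cycle_alternating[OF M(1) C M(2) EV])
    obtain A where A: "bicoloured A ?H" using el[OF nice] by (auto simp: bipartite_iff)
    have elem: "elementary ?W ?H" using el[OF nice] by blast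
    have sgH: "sgraph ?W ?H" by (rule IC_sgraph[OF G])
    have CH: "C \<subseteq> ?H" by (rule subset_IC_edges[OF C(1)])
    \<comment> \<open>An edge of I[C] outside C need not touch C; if it does not, connectedness of
      I[C] supplies one that leaves C.\<close>
    have "\<exists>e\<in>?H - C. e \<inter> \<Union>C \<noteq> {}"
    proof -
      obtain f where f: "f \<in> ?H - C" using False CH by blast
      show ?thesis
      proof (cases "f \<inter> \<Union>C = {}")
        case True
        obtain u where u: "u \<in> f" using simple_edges_nonempty[OF sgraph_simple_edges[OF sgH]] f by blast
        obtain c where c: "c \<in> \<Union>C"
          using C simple_edges_nonempty[OF sgraph_simple_edges[OF sg]] unfolding is_cycle_def by blast
        have "u \<in> ?W" "c \<in> ?W" "u \<notin> \<Union>C" using u f c CH sgH True unfolding sgraph_def by blast+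
        moreover have "graph_connected ?W {e \<in> ?H. allowed_edge ?W ?H e}" using elem by (simp add: elementary_def)
        ultimately obtain x y where "{x, y} \<in> {e \<in> ?H. allowed_edge ?W ?H e}" "x \<in> \<Union>C" "y \<notin> \<Union>C"
          using graph_connected_cut[of ?W _ c u "\<Union>C"] c by blast
        then show ?thesis by (intro bexI[of _ "{x, y}"]) auto
      qed (use f in blast)
    qed
    then obtain e x where e: "e \<in> ?H" "e \<notin> C" "x \<in> e" "x \<in> \<Union>C" by blast
    obtain N where N: "perfect_matching ?W ?H N" "e \<in> N"
      using elementary_bipartite_allowed[OF sgH A elem e(1)] by (auto simp: allowed_edge_def)
    define N' where "N' = N \<union> (M - ?H)"
    have N': "perfect_matching V E N'"
      unfolding N'_def by (rule perfect_matching_extend_IC[OF G C M N(1)])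
    have NH: "N \<subseteq> ?H" using N(1) by (simp add: perfect_matching_def)
    \<comment> \<open>P stands for M or \<open>sym_diff M C\<close>. Both agree with N' outside
      I[C], so D lies in I[C]. At x the matching N' uses e, which is not in C; so the edge of C at x
      that P lacks is missing from N' as well, and D is not C.\<close>
    have flip: "?R\<^sup>*\<^sup>* Q (sym_diff Q D)"
      if P: "P - ?H = M - ?H" "alternating P C" and Q: "perfect_matching V E Q" "alternating Q D"
        and D: "D \<subseteq> sym_diff P N'" "is_cycle D" for P Q D
    proof -
      have DH: "D \<subseteq> ?H" using D(1) P(1) NH unfolding N'_def by blast
      have "D \<noteq> C"
      proof
        assume "D = C"
        obtain g where g: "g \<in> C - P" "x \<in> g"
          using P(2) e(4) unfolding alternating_def by (meson perfect_matchingE)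
        then have "g \<in> N'" using D(1) \<open>D = C\<close> by blast
        moreover have "e \<in> N'" using N(2) by (simp add: N'_def)
        moreover have "x \<in> V" using EV e(4) C(1) by blast
        ultimately have "g = e" using perfect_matching_unique[OF N'] g(2) e(3) by blast
        then show False using g(1) e(2) by blast
      qed
      then have "IC_edges E \<gamma> D \<subset> ?H" by (rule IC_mono(3)[OF G C DH D(2)])
      then have "card (IC_edges E \<gamma> D) < card ?H"
        using psubset_card_mono sgraph_simple_edges[OF sgH] by blast
      then show ?thesis
        using less.hyps[OF _ Q(1) _ D(2) Q(2)] DH IC_edges_subset by blast
    qed
    have "?R\<^sup>*\<^sup>* M N'" by (rule flips_connect[OF sg M(1) N']) (rule flip[OF _ M(2)], auto)
    moreover have "?R\<^sup>*\<^sup>* N' ?M"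
    proof (rule flips_connect[OF sg N' M'(1)])
      fix Q D assume "perfect_matching V E Q" "D \<subseteq> sym_diff N' ?M" "is_cycle D" "alternating Q D"
      moreover have "?M - ?H = M - ?H" using CH by blast
      moreover have "sym_diff N' ?M = sym_diff ?M N'" by blast
      ultimately show "?R\<^sup>*\<^sup>* Q (sym_diff Q D)" using flip[OF _ M'(2)] by simp
    qed
    ultimately show ?thesis by (rule rtranclp_trans)
  qed
qed

text \<open>What is remembered of a single step of a walk.\<close>

definition resonant_face where
  "resonant_face V E \<gamma> F \<longleftrightarrow> interior_face E \<gamma> F \<and> is_cycle (face_boundary E \<gamma> F) \<and>
     (\<exists>P. perfect_matching V E P \<and> perfect_matching V E (sym_diff P (face_boundary E \<gamma> F)))"

text \<open>The difference of M and N is the sum modulo 2 of the boundaries flipped. Testing it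
  against an arbitrary T keeps just enough of this and spares multiplicities; T will be the
  \<open>odd_edges\<close> about a point.\<close>

lemma resonance_walk_faces:
  assumes sg: "sgraph V E" and "(resonance_adj V E \<gamma>)\<^sup>*\<^sup>* M N" "perfect_matching V E M"
  shows "\<exists>\<F>. finite \<F> \<and> (\<forall>F\<in>\<F>. resonant_face V E \<gamma> F) \<and>
    (\<forall>T. odd (card (sym_diff M N \<inter> T)) \<longrightarrow> (\<exists>F\<in>\<F>. odd (card (face_boundary E \<gamma> F \<inter> T))))"
  using assms(2)
proof (induction rule: rtranclp_induct)
  case base
  then show ?case by (intro exI[of _ "{}"]) simp
next
  case (step N N')
  then obtain \<F> where \<F>: "finite \<F>" "\<forall>F\<in>\<F>. resonant_face V E \<gamma> F"
    "\<And>T. odd (card (sym_diff M N \<inter> T)) \<Longrightarrow> \<exists>F\<in>\<F>. odd (card (face_boundary E \<gamma> F \<inter> T))" by blast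
  obtain F where F: "perfect_matching V E N" "perfect_matching V E N'" "interior_face E \<gamma> F"
    "is_cycle (face_boundary E \<gamma> F)" "sym_diff N N' = face_boundary E \<gamma> F"
    using step(2) by (auto simp: resonance_adj_def)
  let ?B = "face_boundary E \<gamma> F"
  have N': "sym_diff N ?B = N'" unfolding F(5)[symmetric] by (rule sym_diff_cancel)
  then have res: "resonant_face V E \<gamma> F" using F by (auto simp: resonant_face_def)
  have "\<exists>F'\<in>insert F \<F>. odd (card (face_boundary E \<gamma> F' \<inter> T))"
    if T: "odd (card (sym_diff M N' \<inter> T))" for T
  proof -
    have "finite E" using sgraph_simple_edges[OF sg] by blast
    moreover have "sym_diff M N \<subseteq> E" "?B \<subseteq> E"
      using F(1) assms(3) face_boundary_subset by (auto simp: perfect_matching_def)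
    ultimately have fin: "finite (sym_diff M N \<inter> T)" "finite (?B \<inter> T)"
      by (meson finite_Int finite_subset)+
    have "sym_diff M N' \<inter> T = sym_diff (sym_diff M N \<inter> T) (?B \<inter> T)" using N' by blast
    then have "odd (card (sym_diff M N \<inter> T)) \<noteq> odd (card (?B \<inter> T))"
      using T odd_card_sym_diff[OF fin] by simp
    then show ?thesis using \<F>(3) by blast
  qed
  then show ?case using \<F> res by (intro exI[of _ "insert F \<F>"]) auto
qed

lemma even_card_resonant:
  assumes sg: "sgraph V E" and F: "resonant_face V E \<gamma> F"
  shows "even (card (face_boundary E \<gamma> F))"
proof -
  let ?B = "face_boundary E \<gamma> F"
  obtain P where P: "perfect_matching V E P" "perfect_matching V E (sym_diff P ?B)" and B: "is_cycle ?B"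
    using F by (auto simp: resonant_face_def)
  have EV: "\<Union>E \<subseteq> V" using sg by (auto simp: sgraph_def)
  have "?B \<subseteq> sym_diff P (sym_diff P ?B)" by blast
  then have "alternating P ?B" by (rule alternating_subset_sym_diff[OF P EV _ B])
  then show ?thesis
    by (rule even_card_alternating[OF simple_edges_subset[OF sgraph_simple_edges[OF sg] face_boundary_subset]])
qed

text \<open>Vertices not reachable from C would lie inside C, where all edges of the graph belong to
  I[C]; they would then be cut off in the whole graph, too.\<close>

lemma IC_connected:
  assumes G: "plane_graph V E \<gamma>" and con: "graph_connected V E" and C: "C \<subseteq> E" "is_cycle C"
  shows "graph_connected (IC_vertices V \<gamma> C) (IC_edges E \<gamma> C)"
proof -
  let ?H = "IC_edges E \<gamma> C" and ?W = "IC_vertices V \<gamma> C"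
  have sg: "sgraph V E" by (rule plane_graph_sgraph[OF G])
  obtain c where c: "c \<in> \<Union>C"
    using C simple_edges_nonempty[OF sgraph_simple_edges[OF sg]] unfolding is_cycle_def by blast
  define Y where "Y = {v \<in> ?W. \<not> (\<lambda>x y. {x, y} \<in> ?H)\<^sup>*\<^sup>* c v}"
  have "graph_connected (\<Union>C) ?H"
    using C(2) by (intro graph_connected_mono[OF _ subset_IC_edges[OF C(1)]]) (simp add: is_cycle_def)
  then have YC: "Y \<inter> \<Union>C = {}" using c by (auto simp: Y_def graph_connected_def)
  have "Y = {}"
  proof (rule ccontr)
    assume "Y \<noteq> {}"
    then obtain v where v: "v \<in> Y" by blast
    have "v \<in> V" using v by (auto simp: Y_def IC_vertices_def)
    moreover have "c \<in> V" using c C(1) sg by (auto simp: sgraph_def)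
    moreover have "c \<notin> Y" by (simp add: Y_def)
    ultimately obtain u w where uw: "{u, w} \<in> E" "u \<in> Y" "w \<notin> Y"
      using graph_connected_cut[OF con, of v c Y] v by blast
    have "u \<in> inside (drawing \<gamma> C)"
      using uw(2) YC IC_vertices_eq[OF G C(1)] by (auto simp: Y_def)
    then have e: "{u, w} \<in> ?H" using inside_vertex_edge[OF G C uw(1)] by blast
    then have "w \<in> ?W" using IC_sgraph[OF G, of C] by (auto simp: sgraph_def)
    then have "(\<lambda>x y. {x, y} \<in> ?H)\<^sup>*\<^sup>* c w" using uw(3) by (simp add: Y_def)
    moreover have "{w, u} \<in> ?H" using e by (simp add: insert_commute)
    ultimately have "(\<lambda>x y. {x, y} \<in> ?H)\<^sup>*\<^sup>* c u" by (rule rtranclp.rtrancl_into_rtrancl)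
    then show False using uw(2) by (simp add: Y_def)
  qed
  then show ?thesis by (intro graph_connectedI_root[of _ _ c]) (auto simp: Y_def)
qed

text \<open>The situation after a walk from M to \<open>sym_diff M C\<close>, with
  \<open>\<F>\<close> the faces flipped.\<close>

locale covered_cycle =
  fixes V :: "complex set" and E \<gamma> C \<F>
  assumes G: "plane_graph V E \<gamma>" and C: "C \<subseteq> E" "is_cycle C"
    and fin: "finite \<F>" and res: "\<And>F. F \<in> \<F> \<Longrightarrow> resonant_face V E \<gamma> F"
    and par: "\<And>T. odd (card (C \<inter> T)) \<Longrightarrow> \<exists>F\<in>\<F>. odd (card (face_boundary E \<gamma> F \<inter> T))"
begin

lemma face: "F \<in> \<F> \<Longrightarrow> interior_face E \<gamma> F" "F \<in> \<F> \<Longrightarrow> is_cycle (face_boundary E \<gamma> F)"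
  using res by (auto simp: resonant_face_def)

lemma face_disjoint: "F \<in> \<F> \<Longrightarrow> F \<inter> drawing \<gamma> E = {}"
  using face(1) in_components_subset unfolding interior_face_def by blast

text \<open>C meets the odd edges about z in an odd number, so some flipped boundary does, and z
  lies inside it. Only the curves of C and of the flipped boundaries have to avoid z, because
  \<open>edge_on_face\<close> takes z on a further edge.\<close>

lemma inside_covered:
  assumes z: "z \<in> inside (drawing \<gamma> C)" "z \<notin> V"
    and zE: "z \<notin> drawing \<gamma> (C \<union> (\<Union>F\<in>\<F>. face_boundary E \<gamma> F))"
  shows "\<exists>F\<in>\<F>. z \<in> F"
proof -
  \<comment> \<open>The parity criterion needs z off the whole drawing, so the graph is cut down to
    the edges involved.\<close>
  define E' where "E' = C \<union> (\<Union>F\<in>\<F>. face_boundary E \<gamma> F)"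
  have zE': "z \<notin> drawing \<gamma> E'" using zE by (simp add: E'_def)
  have "E' \<subseteq> E" using C(1) face_boundary_subset unfolding E'_def by blast
  then have G': "plane_graph V E' \<gamma>" by (rule plane_graph_subset[OF G])
  have CE': "C \<subseteq> E'" by (simp add: E'_def)
  have "odd (card (C \<inter> odd_edges E' \<gamma> z))"
    using cycle_curve[OF G' CE' C(2)] z(1) zE' by metis
  then obtain F where F: "F \<in> \<F>" "odd (card (face_boundary E \<gamma> F \<inter> odd_edges E' \<gamma> z))" using par by blast
  have "face_boundary E \<gamma> F \<subseteq> E'" using F(1) by (auto simp: E'_def)
  then have "z \<in> inside (drawing \<gamma> (face_boundary E \<gamma> F))"
    using cycle_curve[OF G' _ face(2)[OF F(1)]] F(2) zE' by metis
  then show ?thesis using interior_face_cycle(2)[OF G face[OF F(1)]] z(2) F(1) by blast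
qed

text \<open>Otherwise a point of the open arc of e would be covered by a flipped face, but faces
  avoid the drawing.\<close>

lemma edge_on_face:
  assumes e: "e \<in> IC_edges E \<gamma> C" "e \<notin> C"
  shows "\<exists>F\<in>\<F>. e \<in> face_boundary E \<gamma> F"
proof (rule ccontr)
  assume not: "\<not> ?thesis"
  have eE: "e \<in> E" using e(1) IC_edges_subset by blast
  obtain p where p: "p \<in> edge_interior \<gamma> e" using edge_interior_props(2)[OF G eE] by blast
  have "p \<in> inside (drawing \<gamma> C)" using IC_edges_iff[OF G C eE] e p by blast
  moreover have "p \<notin> V" using edge_interior_props(4)[OF G eE] p by blast
  moreover have "p \<notin> drawing \<gamma> (C \<union> (\<Union>F\<in>\<F>. face_boundary E \<gamma> F))"
  proof
    assume "p \<in> drawing \<gamma> (C \<union> (\<Union>F\<in>\<F>. face_boundary E \<gamma> F))"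
    then have "e \<in> C \<union> (\<Union>F\<in>\<F>. face_boundary E \<gamma> F)"
      by (rule edge_interior_drawing[OF G eE _ p, rotated]) (use C(1) face_boundary_subset in blast)
    then show False using e(2) not by blast
  qed
  ultimately obtain F where "F \<in> \<F>" "p \<in> F" using inside_covered by blast
  moreover have "p \<in> drawing \<gamma> E" using p eE by (auto simp: edge_interior_def drawing_def)
  ultimately show False using face_disjoint by blast
qed

text \<open>Adding an inner face of an odd cycle D that borders D yields a smaller odd cycle.\<close>

lemma even_cycle:
  assumes "D \<subseteq> IC_edges E \<gamma> C" "is_cycle D"
  shows "even (card D)"
  using assms
proof (induction "card (IC_edges E \<gamma> D)" arbitrary: D rule: less_induct)
  case less
  note D = less.prems
  have sg: "sgraph V E" by (rule plane_graph_sgraph[OF G])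
  have DE: "D \<subseteq> E" using D(1) IC_edges_subset by blast
  have S: "simple_edges D" by (rule simple_edges_subset[OF sgraph_simple_edges[OF sg] DE])
  note J = cycle_Jordan[OF G DE D(2)]
  show ?case
  proof (rule ccontr)
    assume odd: "odd (card D)"
    obtain e where e: "e \<in> D" using D(2) by (auto simp: is_cycle_def)
    then have eE: "e \<in> E" using DE by blast
    obtain p where p: "p \<in> edge_interior \<gamma> e" using edge_interior_props(2)[OF G eE] by blast
    define \<D> where "\<D> = {F \<in> \<F>. F \<subseteq> inside (drawing \<gamma> D)}"
    have pD: "p \<in> drawing \<gamma> D" using p e by (auto simp: edge_interior_def drawing_def)
    have finV: "finite V" using sg by (simp add: sgraph_def)
    \<comment> \<open>Points inside D off all curves and vertices are dense near p and lie in
      finitely many faces, so p is in the closure of one of these.\<close>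
    have "p \<in> closure (inside (drawing \<gamma> D) - drawing \<gamma> E - V)"
      using pD closure_diff_drawing[OF G order_refl J(2) finV] J(10) by blast
    also have "\<dots> \<subseteq> (\<Union>F\<in>\<D>. closure F)"
    proof (rule closure_minimal)
      show "closed (\<Union>F\<in>\<D>. closure F)" using fin by (intro closed_UN) (auto simp: \<D>_def)
      show "inside (drawing \<gamma> D) - drawing \<gamma> E - V \<subseteq> (\<Union>F\<in>\<D>. closure F)"
      proof
        fix z assume z: "z \<in> inside (drawing \<gamma> D) - drawing \<gamma> E - V"
        have "C \<union> (\<Union>F\<in>\<F>. face_boundary E \<gamma> F) \<subseteq> E" using C(1) face_boundary_subset by blast
        then have "z \<notin> drawing \<gamma> (C \<union> (\<Union>F\<in>\<F>. face_boundary E \<gamma> F))" using z drawing_mono by blast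
        moreover have "z \<in> inside (drawing \<gamma> C)" using IC_mono(2)[OF G C D] z by blast
        ultimately obtain F where F: "F \<in> \<F>" "z \<in> F" using inside_covered z by blast
        have "connected F" using face(1)[OF F(1)] in_components_connected by (auto simp: interior_face_def)
        moreover have "F \<inter> drawing \<gamma> D = {}" using face_disjoint[OF F(1)] drawing_mono[OF DE] by blast
        ultimately have "F \<subseteq> inside (drawing \<gamma> D) \<or> F \<subseteq> outside (drawing \<gamma> D)"
          by (rule connected_inside_or_outside[OF G DE D(2)])
        then have "F \<subseteq> inside (drawing \<gamma> D)"
          using F(2) z inside_Int_outside[of "drawing \<gamma> D"] by blast
        then show "z \<in> (\<Union>F\<in>\<D>. closure F)" using F closure_subset unfolding \<D>_def by blast
      qed
    qed
    finally obtain F where F: "F \<in> \<F>" "F \<subseteq> inside (drawing \<gamma> D)" "p \<in> closure F" by (auto simp: \<D>_def)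
    let ?B = "face_boundary E \<gamma> F"
    have FC: "F \<in> components (- drawing \<gamma> E)" using face(1)[OF F(1)] by (simp add: interior_face_def)
    have "p \<notin> F" using face_disjoint[OF F(1)] pD drawing_mono[OF DE] by blast
    then have "p \<in> frontier F" using F(3) by (simp add: closure_Un_frontier)
    then have eB: "e \<in> ?B" using frontier_face_edge[OF G FC eE p] eE by (simp add: face_boundary_def)
    have BD: "?B \<subseteq> IC_edges E \<gamma> D"
    proof
      fix f assume f: "f \<in> ?B"
      have "frontier F \<subseteq> closure (inside (drawing \<gamma> D))"
        using closure_mono[OF F(2)] by (auto simp: frontier_def)
      then show "f \<in> IC_edges E \<gamma> D" using f J(10) by (auto simp: face_boundary_def IC_edges_def)
    qed
    \<comment> \<open>Since the boundary of F is even, this set has odd size; its degrees are even,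
      it lies in I[D], and it lacks e. So it contains an odd cycle other than D.\<close>
    let ?S = "sym_diff D ?B"
    have SS: "?S \<subseteq> IC_edges E \<gamma> D" using BD subset_IC_edges[OF DE] by blast
    have finB: "finite ?B" "finite D"
      using face(2)[OF F(1)] D(2) by (simp_all add: is_cycle_def)
    have ev: "even (card (edges_at K v))" if "is_cycle K" for K v
      using is_cycle_edges_at[OF that, of v] edges_at_empty_iff[of K v] by (cases "v \<in> \<Union>K") auto
    have "even (card (edges_at ?S v))" for v
      using odd_card_sym_diff[of "edges_at D v" "edges_at ?B v"] finB
        ev[OF D(2), of v] ev[OF face(2)[OF F(1)], of v]
      by (simp add: edges_at_sym_diff)
    moreover have "odd (card ?S)"
      using odd_card_sym_diff[OF finB(2,1)] odd even_card_resonant[OF sg res[OF F(1)]] by simp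
    moreover have "simple_edges ?S"
      using simple_edges_subset[OF sgraph_simple_edges[OF IC_sgraph[OF G]] SS] .
    ultimately obtain D' where D': "D' \<subseteq> ?S" "is_cycle D'" "odd (card D')"
      using exists_odd_cycle[of ?S] by blast
    have "D' \<noteq> D" using D'(1) e eB by blast
    have D'D: "D' \<subseteq> IC_edges E \<gamma> D" using D'(1) SS by (rule order_trans)
    have "IC_edges E \<gamma> D' \<subset> IC_edges E \<gamma> D" by (rule IC_mono(3)[OF G DE D(2) D'D D'(2) \<open>D' \<noteq> D\<close>])
    then have "card (IC_edges E \<gamma> D') < card (IC_edges E \<gamma> D)"
      using psubset_card_mono sgraph_simple_edges[OF IC_sgraph[OF G]] by blast
    moreover have "D' \<subseteq> IC_edges E \<gamma> C" using D'D IC_mono(1)[OF G C D] by (rule order_trans)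
    ultimately have "even (card D')" using less.hyps D'(2) by blast
    then show False using D'(3) by blast
  qed
qed

end

text \<open>An edge that is not allowed yields a balanced cut Z of I[C].  The cycle C is contained in the union
  of two matchings that do not cross Z, hence lies on one side of it; no edge of the graph at
  the other side leaves I[C], so no perfect matching of the whole graph crosses Z.\<close>

lemma IC_edge_allowed:
  assumes G: "plane_graph V E \<gamma>" and C: "C \<subseteq> E" "is_cycle C"
    and M: "perfect_matching V E M" "alternating M C"
    and A: "bicoloured A (IC_edges E \<gamma> C)"
    and e: "e \<in> IC_edges E \<gamma> C" and P: "perfect_matching V E P" "e \<in> P"
  shows "allowed_edge (IC_vertices V \<gamma> C) (IC_edges E \<gamma> C) e"
proof (rule ccontr)
  let ?H = "IC_edges E \<gamma> C" and ?W = "IC_vertices V \<gamma> C"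
  assume na: "\<not> allowed_edge ?W ?H e"
  have sgH: "sgraph ?W ?H" by (rule IC_sgraph[OF G])
  have CH: "C \<subseteq> ?H" by (rule subset_IC_edges[OF C(1)])
  let ?M = "sym_diff M C"
  have M': "perfect_matching V E ?M" "alternating ?M C"
    using perfect_matching_sym_diff[OF M(1) C(1) M(2)] alternating_sym_diff_self[OF M(2)] .
  note MH = perfect_matching_restrict_IC[OF G C M] and MH' = perfect_matching_restrict_IC[OF G C M']
  have "card (e \<inter> A) = 1" using A e by (auto simp: bicoloured_def)
  then obtain a where "a \<in> e" "a \<in> A" by (metis Int_iff card_1_singletonE insertI1)
  then obtain b where ab: "e = {a, b}" using simple_edgesE[OF sgraph_simple_edges[OF sgH] e] by metis
  obtain Z where Z: "Z \<subseteq> ?W" "b \<in> Z" "a \<notin> Z" "card (Z \<inter> A) = card (Z - A)"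
    and nb: "\<And>e. e \<in> ?H \<Longrightarrow> e \<inter> (Z \<inter> A) \<noteq> {} \<Longrightarrow> e \<subseteq> Z"
    by (rule not_allowed_cut[OF sgH A MH, of a b]) (use e na ab \<open>a \<in> A\<close> in auto)
  have aW: "a \<in> ?W" using sgH e ab by (auto simp: sgraph_def)
  have finW: "finite ?W" using sgH by (simp add: sgraph_def)
  then have finZ: "finite Z" using Z(1) finite_subset by blast
  have bic: "card (f \<inter> A) = 1 \<and> card (f - A) = 1" if "f \<in> ?H" for f using A that by (auto simp: bicoloured_def)
  have closed: "f \<subseteq> Z" if N: "perfect_matching ?W ?H N" and f: "f \<in> N" "f \<inter> Z \<noteq> {}" for N f
  proof (rule matching_closed_of_neighbours[OF finZ _ Z(4) _ f])
    show "\<exists>!e. e \<in> N \<and> w \<in> e" if "w \<in> Z" for w using perfect_matching_ex1[OF N] that Z(1) by blast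
    show "f \<subseteq> Z \<and> card (f \<inter> A) = 1 \<and> card (f - A) = 1" if "f \<in> N" "f \<inter> (Z \<inter> A) \<noteq> {}" for f
    proof -
      have "f \<in> ?H" using N that(1) by (auto simp: perfect_matching_def)
      then show ?thesis using nb[OF _ that(2)] bic by blast
    qed
  qed
  have Cclosed: "f \<subseteq> Z" if "f \<in> C" "f \<inter> Z \<noteq> {}" for f
  proof -
    have "f \<in> M \<inter> ?H \<or> f \<in> ?M \<inter> ?H" using that(1) CH by blast
    then show ?thesis using closed[OF MH _ that(2)] closed[OF MH' _ that(2)] by blast
  qed
  have side: "\<Union>C \<inter> Z = {} \<or> \<Union>C \<subseteq> Z"
  proof (rule ccontr)
    assume "\<not> ?thesis"
    then obtain x y where xy: "x \<in> \<Union>C" "x \<in> Z" "y \<in> \<Union>C" "y \<notin> Z" by blast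
    have "graph_connected (\<Union>C) C" using C(2) by (simp add: is_cycle_def)
    then obtain u v where "{u, v} \<in> C" "u \<in> Z" "v \<notin> Z"
      using graph_connected_cut[OF _ xy(1,3,2,4)] by blast
    then show False using Cclosed[of "{u, v}"] by blast
  qed
  \<comment> \<open>P may match vertices of C to the outside, so only its edges at vertices strictly
    inside C are known to lie in I[C].\<close>
  have ins: "f \<in> ?H" if "f \<in> P" "v \<in> f" "v \<in> ?W" "v \<notin> \<Union>C" for f v
  proof -
    have "f \<in> E" using P(1) that(1) by (auto simp: perfect_matching_def)
    moreover have "v \<in> inside (drawing \<gamma> C)" using that(3,4) IC_vertices_eq[OF G C(1)] by blast
    ultimately show ?thesis using inside_vertex_edge[OF G C _ that(2)] by blast
  qed
  have PW: "\<exists>!e. e \<in> P \<and> w \<in> e" if "w \<in> ?W" for w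
    by (rule perfect_matching_ex1[OF P(1)]) (use that in \<open>simp add: IC_vertices_def\<close>)
  from side show False
  proof
    assume out: "\<Union>C \<inter> Z = {}"
    have "e \<subseteq> Z"
    proof (rule matching_closed_of_neighbours[OF finZ _ Z(4) _ P(2)])
      show "\<exists>!e. e \<in> P \<and> w \<in> e" if "w \<in> Z" for w using PW that Z(1) by blast
      show "f \<subseteq> Z \<and> card (f \<inter> A) = 1 \<and> card (f - A) = 1" if f: "f \<in> P" "f \<inter> (Z \<inter> A) \<noteq> {}" for f
      proof -
        obtain v where "v \<in> f" "v \<in> Z" using f(2) by blast
        then have "f \<in> ?H" using ins[OF f(1)] out Z(1) by blast
        then show ?thesis using nb[OF _ f(2)] bic by blast
      qed
    qed (use ab Z(2) in auto)
    then show False using ab Z(3) by blast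
  next
    assume inn: "\<Union>C \<subseteq> Z"
    \<comment> \<open>The complement of Z takes over with the colours exchanged: an edge of I[C]
      from \<open>Y - A\<close> cannot end in \<open>Z \<inter> A\<close>, since edges at
      \<open>Z \<inter> A\<close> stay in Z.\<close>
    define Y where "Y = ?W - Z"
    have finY: "finite Y" using finW by (simp add: Y_def)
    have "card (Y \<inter> A) = card (Y - A)"
    proof (rule perfect_matching_balanced[OF sgH A MH])
      fix f assume f: "f \<in> M \<inter> ?H" "f \<inter> Y \<noteq> {}"
      then have "f \<inter> Z = {}" using closed[OF MH f(1)] unfolding Y_def by blast
      moreover have "f \<subseteq> ?W" using f(1) sgH by (auto simp: sgraph_def)
      ultimately show "f \<subseteq> Y" unfolding Y_def by blast
    qed (simp add: Y_def)
    then have bal: "card (Y \<inter> - A) = card (Y - - A)" by (simp add: Diff_eq)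
    have "e \<subseteq> Y"
    proof (rule matching_closed_of_neighbours[OF finY _ bal _ P(2)])
      show "\<exists>!e. e \<in> P \<and> w \<in> e" if "w \<in> Y" for w using PW that by (simp add: Y_def)
      show "f \<subseteq> Y \<and> card (f \<inter> - A) = 1 \<and> card (f - - A) = 1" if f: "f \<in> P" "f \<inter> (Y \<inter> - A) \<noteq> {}" for f
      proof -
        obtain v where v: "v \<in> f" "v \<in> Y" "v \<notin> A" using f(2) by blast
        then have fH: "f \<in> ?H" using ins[OF f(1)] inn unfolding Y_def by blast
        obtain w where w: "f = {v, w}" using simple_edgesE[OF sgraph_simple_edges[OF sgH] fH v(1)] by metis
        have "w \<in> A" using bicoloured_edge[OF A] fH w v(3) by blast
        then have "w \<notin> Z" using nb[OF fH] w v(2) unfolding Y_def by blast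
        moreover have "f \<subseteq> ?W" using fH sgH by (auto simp: sgraph_def)
        ultimately have "f \<subseteq> Y" using w v(2) unfolding Y_def by blast
        then show ?thesis using bic[OF fH] by (simp add: Diff_eq)
      qed
    qed (use ab aW Z(3) in \<open>auto simp: Y_def\<close>)
    then show False using ab Z(2) unfolding Y_def by blast
  qed
qed

theorem theorem3p2:
  fixes V :: "complex set" and E :: "complex set set" and \<gamma> :: "complex set \<Rightarrow> real \<Rightarrow> complex"
  assumes "plane_graph V E \<gamma>"
    and "graph_connected V E"
    and "\<exists>M. perfect_matching V E M"
  shows "resonance_connected V E \<gamma> \<longleftrightarrow>
    (\<forall>C. nice_cycle V E C \<longrightarrow>
        bipartite (IC_vertices V \<gamma> C) (IC_edges E \<gamma> C) \<and>
        elementary (IC_vertices V \<gamma> C) (IC_edges E \<gamma> C))"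
proof
  note G = assms(1)
  have sg: "sgraph V E" by (rule plane_graph_sgraph[OF G])
  assume R: "resonance_connected V E \<gamma>"
  show "\<forall>C. nice_cycle V E C \<longrightarrow>
        bipartite (IC_vertices V \<gamma> C) (IC_edges E \<gamma> C) \<and>
        elementary (IC_vertices V \<gamma> C) (IC_edges E \<gamma> C)"
  proof (intro allI impI)
    fix C assume nice: "nice_cycle V E C"
    then have C: "C \<subseteq> E" "is_cycle C" by (auto simp: nice_cycle_def cycle_of_def)
    let ?H = "IC_edges E \<gamma> C" and ?W = "IC_vertices V \<gamma> C"
    obtain M where M: "perfect_matching V E M" "alternating M C"
      using nice_cycle_exists_alternating[OF sg _ nice] assms(3) by blast
    have M': "perfect_matching V E (sym_diff M C)" by (rule perfect_matching_sym_diff[OF M(1) C(1) M(2)])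
    then have walk: "(resonance_adj V E \<gamma>)\<^sup>*\<^sup>* M (sym_diff M C)"
      using R M(1) by (simp add: resonance_connected_def)
    obtain \<F> where \<F>: "finite \<F>" "\<forall>F\<in>\<F>. resonant_face V E \<gamma> F"
      "\<forall>T. odd (card (sym_diff M (sym_diff M C) \<inter> T)) \<longrightarrow> (\<exists>F\<in>\<F>. odd (card (face_boundary E \<gamma> F \<inter> T)))"
      using resonance_walk_faces[OF sg walk M(1)] by blast
    interpret covered_cycle V E \<gamma> C \<F>
      by unfold_locales (use G C \<F> in \<open>auto simp: sym_diff_cancel\<close>)
    have con: "graph_connected ?W ?H" by (rule IC_connected[OF G assms(2) C])
    have bip: "bipartite ?W ?H"
      by (rule bipartite_if_no_odd_cycle[OF IC_sgraph[OF G] con even_cycle])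
    then obtain A where A: "bicoloured A ?H" by (auto simp: bipartite_iff)
    have "allowed_edge ?W ?H e" if e: "e \<in> ?H" for e
    proof -
      \<comment> \<open>An edge of a flipped boundary lies in one of the two perfect matchings that
        the flip exchanges; the same holds for C itself.\<close>
      have "\<exists>P. perfect_matching V E P \<and> e \<in> P"
      proof (cases "e \<in> C")
        case True
        then show ?thesis using M(1) M' by blast
      next
        case False
        then obtain F where F: "F \<in> \<F>" "e \<in> face_boundary E \<gamma> F" using edge_on_face[OF e] by blast
        then obtain P where "perfect_matching V E P" "perfect_matching V E (sym_diff P (face_boundary E \<gamma> F))"
          using \<F>(2) by (auto simp: resonant_face_def)
        then show ?thesis using F(2) by blast
      qed
      then show ?thesis using IC_edge_allowed[OF G C M A e] by blast
    qed
    then have "{e \<in> ?H. allowed_edge ?W ?H e} = ?H" by blast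
    then have "elementary ?W ?H"
      using con perfect_matching_restrict_IC[OF G C M] by (auto simp: elementary_def)
    with bip show "bipartite ?W ?H \<and> elementary ?W ?H" by blast
  qed
next
  assume el: "\<forall>C. nice_cycle V E C \<longrightarrow>
        bipartite (IC_vertices V \<gamma> C) (IC_edges E \<gamma> C) \<and>
        elementary (IC_vertices V \<gamma> C) (IC_edges E \<gamma> C)"
  show "resonance_connected V E \<gamma>"
    unfolding resonance_connected_def
  proof (intro allI impI)
    fix P Q assume P: "perfect_matching V E P" and Q: "perfect_matching V E Q"
    show "(resonance_adj V E \<gamma>)\<^sup>*\<^sup>* P Q"
    proof (rule flips_connect[OF plane_graph_sgraph[OF assms(1)] P Q])
      fix M D assume M: "perfect_matching V E M" "D \<subseteq> sym_diff P Q" "is_cycle D" "alternating M D"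
      have "sym_diff P Q \<subseteq> E" using P Q by (auto simp: perfect_matching_def)
      with M(2) have "D \<subseteq> E" by (rule order_trans)
      with el M show "(resonance_adj V E \<gamma>)\<^sup>*\<^sup>* M (sym_diff M D)"
        by (intro flip_cycle[OF assms(1)]) auto
    qed
  qed
qed

end
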